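(* For $2w\le n$, let $\mathbb{F}_2^{n,w}$ be the set of binary vectors of length $n$ with exactly $w$ ones, with distance $\tau(x,y)=|\{i:x_i\ne y_i\}|/2$, and let $A(\mathbb{F}_2^{n,w},s)$ be the maximum cardinality of a subset $X\subset\mathbb{F}_2^{n,w}$ whose set of distances between distinct elements has exactly $s$ elements. (1) For $11\le n\le 45$ and $4\le w\le n/2$, $A(\mathbb{F}_2^{n,w},3)\le \binom{n}{3}-\binom{n}{2}+n$. (2) If $n,w$ satisfy one of: $11\le n\le12$ and $w=4$; $13\le n\le 15$ and $4\le w\le 5$; $16\le n\le 19$ and $4\le w\le 6$; $20\le n\le 24$ and $4\le w\le 7$; $25\le n\le 50$ and $4\le w\le 8$; then $A(\mathbb{F}_2^{n,w},3)=\binom{n-w+3}{3}$.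
   Context: None beyond the definitions in the claim. *)

theory Defs
  imports Complex_Main "HOL-Library.Z2"
begin

definition johnson_space :: "nat \<Rightarrow> nat \<Rightarrow> bit list set" where
  "johnson_space n w = {x. length x = n \<and> card {i. i < n \<and> x ! i = 1} = w}"

(* Meant for lists of equal length. *)
definition tau :: "bit list \<Rightarrow> bit list \<Rightarrow> real" where
  "tau x y = real (card {i. i < length x \<and> x ! i \<noteq> y ! i}) / 2"

definition distance_set :: "bit list set \<Rightarrow> real set" where
  "distance_set X = {tau x y | x y. x \<in> X \<and> y \<in> X \<and> x \<noteq> y}"

(* Max ranges over a finite set; it is unspecified if no subset has exactly s distances,
   which cannot happen for s \<le> w and 2 * w \<le> n. *)
definition max_s_distance :: "nat \<Rightarrow> nat \<Rightarrow> nat \<Rightarrow> nat" where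
  "max_s_distance n w s =
     Max (card ` {X. X \<subseteq> johnson_space n w \<and> card (distance_set X) = s})"

end

theory Submission
  imports Defs
begin

text \<open>Vectors are identified with their supports, so a code becomes a family \<open>F\<close> of \<open>w\<close>-subsets of an
  \<open>n\<close>-set with distance \<open>|S - T|\<close>. Suppose \<open>F\<close> has distances \<open>x < y < z\<close>.

  If \<open>F\<close> has more than \<open>n choose 2\<close> members, some nonzero weighting of \<open>F\<close> kills all polynomials of degree at most
  2. Applying it to \<open>(y - d) (z - d)\<close> exhibits \<open>- y z / ((y - x) (z - x))\<close> as an eigenvalue of the graph of the
  distance \<open>x\<close>, so this rational number is an integer, and only a few triples remain (Larman, Rogers and Seidel).

  In the expansion of \<open>(x - d) (y - d) (z - d)\<close> into Hahn polynomials, the coefficient of degree 2 is nonpositive iff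
  \<open>(x + y + z - 3) (n - 4) \<le> 3 (w - 2) (n - w - 2)\<close>. In that case a weighting of \<open>F\<close> orthogonal to the harmonics of
  degree 0, 1 and 3 must vanish, which bounds \<open>|F|\<close> by the dimension \<open>(n choose 3) - (n choose 2) + n\<close> of these.

  In the remaining cases Delsarte's linear programming bound suffices. As the pair \<open>(w, n - w)\<close> may be increased
  by adding common ones and zeros, few dual solutions cover all parameters. In part (2) they settle all integral triples,
  and the vectors with \<open>w - 3\<close> fixed ones attain the bound.\<close>

section \<open>Integral solutions of homogeneous systems\<close>

text \<open>Gaussian elimination, one equation at a time. A pivot unknown is eliminated by
  cross-multiplication rather than division, so the solution stays integral, as the later descent
  argument requires.\<close>

lemma exists_nonzero_int_solution:
  fixes M :: "'a \<Rightarrow> 'b \<Rightarrow> int"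
  assumes "finite B" "finite A" "card B < card A"
  shows "\<exists>v. (\<exists>a\<in>A. v a \<noteq> 0) \<and> (\<forall>b\<in>B. (\<Sum>a\<in>A. v a * M a b) = 0)"
  using assms
proof (induction B arbitrary: A M rule: finite_induct)
  case empty
  then obtain a where "a \<in> A" by (metis card.empty less_numeral_extra(3) ex_in_conv)
  then show ?case by (intro exI[of _ "\<lambda>_. 1"]) auto
next
  case (insert b B)
  show ?case
  proof (cases "\<forall>a\<in>A. M a b = 0")
    case True
    have "card B < card A" using insert by auto
    then obtain v where v: "\<exists>a\<in>A. v a \<noteq> 0" "\<forall>c\<in>B. (\<Sum>a\<in>A. v a * M a c) = 0"
      using insert.IH insert.prems by blast
    moreover have "(\<Sum>a\<in>A. v a * M a b) = 0" using True by simp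
    ultimately show ?thesis by auto
  next
    case False
    then obtain z where z: "z \<in> A" "M z b \<noteq> 0" by auto
    define A' where "A' = A - {z}"
    have A': "finite A'" "card B < card A'" "z \<notin> A'" "A = insert z A'"
      using insert.prems insert.hyps z by (auto simp: A'_def)
    obtain v where v: "\<exists>a\<in>A'. v a \<noteq> 0"
      "\<forall>c\<in>B. (\<Sum>a\<in>A'. v a * (M z b * M a c - M a b * M z c)) = 0"
      using insert.IH[OF A'(1,2), of "\<lambda>a c. M z b * M a c - M a b * M z c"] by blast
    \<comment> \<open>The value at the pivot makes equation \<open>b\<close> hold; the other
      unknowns are scaled by the pivot entry \<open>M z b\<close> so that no division
      occurs.\<close>
    define u where "u a = (if a = z then - (\<Sum>a\<in>A'. v a * M a b) else M z b * v a)" for a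
    have sum: "(\<Sum>a\<in>A. u a * M a c) = (\<Sum>a\<in>A'. v a * (M z b * M a c - M a b * M z c))" for c
    proof -
      have "(\<Sum>a\<in>A'. u a * M a c) = (\<Sum>a\<in>A'. M z b * v a * M a c)"
        using A'(3) by (intro sum.cong) (auto simp: u_def)
      then have "(\<Sum>a\<in>A. u a * M a c)
          = (\<Sum>a\<in>A'. M z b * v a * M a c) - (\<Sum>a\<in>A'. v a * M a b) * M z c"
        using A' by (simp add: u_def)
      also have "\<dots> = (\<Sum>a\<in>A'. v a * (M z b * M a c - M a b * M z c))"
        by (simp add: sum_distrib_left sum_subtractf algebra_simps)
      finally show ?thesis .
    qed
    have "\<exists>a\<in>A. u a \<noteq> 0" using v(1) A' z by (auto simp: u_def)
    moreover have "\<forall>c\<in>insert b B. (\<Sum>a\<in>A. u a * M a c) = 0"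
      using v(2) by (auto simp: sum mult.commute)
    ultimately show ?thesis by blast
  qed
qed

section \<open>Hahn polynomials and the linear programming bound\<close>

definition chi :: "nat set \<Rightarrow> nat \<Rightarrow> int" where
  "chi S p = of_bool (p \<in> S)"

text \<open>Unfolding the recursion, this is the Gram kernel of the products of \<open>k\<close> differences of indicators over
  disjoint ordered pairs; these products span the harmonic functions of degree \<open>k\<close>.\<close>

fun hkernel :: "nat \<Rightarrow> nat set \<Rightarrow> nat set \<Rightarrow> nat set \<Rightarrow> int" where
  "hkernel 0 U S T = 1"
| "hkernel (Suc k) U S T =
     (\<Sum>p\<in>U. \<Sum>q\<in>U. ((chi S p - chi S q) * (chi T p - chi T q)) * hkernel k (U - {p, q}) S T)"

text \<open>With \<open>l = a - d\<close>, \<open>m = b - d\<close> and \<open>s = d\<close> this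
  is, up to a scalar, the Hahn polynomial of degree \<open>k\<close> in the distance
  \<open>d\<close>, the zonal function of the Johnson scheme. The arguments count the points in both
  sets, in neither, and in each one-sided difference; where \<open>s - 1\<close> is negative the
  factor in front is 0.\<close>

fun hahn :: "nat \<Rightarrow> int \<Rightarrow> int \<Rightarrow> int \<Rightarrow> int" where
  "hahn 0 l m s = 1"
| "hahn (Suc k) l m s = l * m * hahn k (l - 1) (m - 1) s - s\<^sup>2 * hahn k l m (s - 1)"

text \<open>A pair contributes only if it separates both sets: a common point with a point outside
  both gives the product 1, a point of each difference gives -1. Removing such a pair leaves cells
  to which the induction applies. Both orders of each pair are counted, whence
  \<open>2 ^ k\<close>.\<close>

lemma hkernel_eq_hahn:
  assumes "finite U" "card (U \<inter> S \<inter> T) = l" "card (U - S - T) = m"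
    "card (U \<inter> S - T) = s" "card (U \<inter> T - S) = s"
  shows "hkernel k U S T = 2 ^ k * hahn k (int l) (int m) (int s)"
  using assms
proof (induction k arbitrary: U l m s)
  case 0
  then show ?case by simp
next
  case (Suc k)
  define A where "A = U \<inter> S \<inter> T"
  define B where "B = U - S - T"
  define C where "C = U \<inter> S - T"
  define D where "D = U \<inter> T - S"
  have fin: "finite A" "finite B" "finite C" "finite D"
    using Suc.prems(1) by (auto simp: A_def B_def C_def D_def)
  have card: "card A = l" "card B = m" "card C = s" "card D = s"
    using Suc.prems by (auto simp: A_def B_def C_def D_def)
  have U: "U = A \<union> B \<union> C \<union> D" by (auto simp: A_def B_def C_def D_def)
  define h where "h p q = hkernel k (U - {p, q}) S T" for p q
  define c where "c p q = (chi S p - chi S q) * (chi T p - chi T q)" for p q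
  have split: "(\<Sum>p\<in>U. g p) = (\<Sum>p\<in>A. g p) + (\<Sum>p\<in>B. g p) + (\<Sum>p\<in>C. g p) + (\<Sum>p\<in>D. g p)"
    for g :: "nat \<Rightarrow> int"
    unfolding U using fin by (simp add: sum.union_disjoint A_def B_def C_def D_def Int_Un_distrib Int_Diff Un_Diff disjoint_iff)
  have diag: "h p q = 2 ^ k * hahn k (int l - 1) (int m - 1) (int s)"
    if "p \<in> A \<and> q \<in> B \<or> p \<in> B \<and> q \<in> A" for p q
  proof -
    have "\<exists>x y. x \<in> A \<and> y \<in> B \<and> {p, q} = {x, y}" using that by auto
    then obtain x y where xy: "x \<in> A" "y \<in> B" "{p, q} = {x, y}" by blast
    have "(U - {x, y}) \<inter> S \<inter> T = A - {x}" "(U - {x, y}) - S - T = B - {y}"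
      "(U - {x, y}) \<inter> S - T = C" "(U - {x, y}) \<inter> T - S = D"
      using xy(1,2) by (auto simp: A_def B_def C_def D_def)
    moreover have "card (A - {x}) = l - 1" "card (B - {y}) = m - 1" "l > 0" "m > 0"
      using xy fin card by (auto simp: card_gt_0_iff)
    ultimately show ?thesis
      using Suc.IH[of "U - {x, y}" "l - 1" "m - 1" s] Suc.prems(1) card
      unfolding h_def xy(3) by (simp add: of_nat_diff)
  qed
  have off: "h p q = 2 ^ k * hahn k (int l) (int m) (int s - 1)"
    if "p \<in> C \<and> q \<in> D \<or> p \<in> D \<and> q \<in> C" for p q
  proof -
    have "\<exists>x y. x \<in> C \<and> y \<in> D \<and> {p, q} = {x, y}" using that by auto
    then obtain x y where xy: "x \<in> C" "y \<in> D" "{p, q} = {x, y}" by blast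
    have "(U - {x, y}) \<inter> S \<inter> T = A" "(U - {x, y}) - S - T = B"
      "(U - {x, y}) \<inter> S - T = C - {x}" "(U - {x, y}) \<inter> T - S = D - {y}"
      using xy(1,2) by (auto simp: A_def B_def C_def D_def)
    moreover have "card (C - {x}) = s - 1" "card (D - {y}) = s - 1" "s > 0"
      using xy fin card by (auto simp: card_gt_0_iff)
    ultimately show ?thesis
      using Suc.IH[of "U - {x, y}" l m "s - 1"] Suc.prems(1) card
      unfolding h_def xy(3) by (simp add: of_nat_diff)
  qed
  have c: "c p q = 1" if "p \<in> A \<and> q \<in> B \<or> p \<in> B \<and> q \<in> A" for p q
    using that by (auto simp: c_def chi_def A_def B_def)
  have c': "c p q = -1" if "p \<in> C \<and> q \<in> D \<or> p \<in> D \<and> q \<in> C" for p q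
    using that by (auto simp: c_def chi_def C_def D_def)
  have zero: "c p q = 0"
    if "p \<in> A \<union> B \<and> q \<in> C \<union> D \<or> p \<in> C \<union> D \<and> q \<in> A \<union> B
      \<or> p \<in> A \<and> q \<in> A \<or> p \<in> B \<and> q \<in> B \<or> p \<in> C \<and> q \<in> C \<or> p \<in> D \<and> q \<in> D" for p q
    using that by (auto simp: c_def chi_def A_def B_def C_def D_def)
  define a where "a = 2 ^ k * hahn k (int l - 1) (int m - 1) (int s)"
  define b where "b = 2 ^ k * hahn k (int l) (int m) (int s - 1)"
  have rA: "(\<Sum>q\<in>U. c p q * h p q) = int m * a" if "p \<in> A" for p
    using that c[of p] diag[of p] zero[of p] by (simp add: split card a_def)
  have rB: "(\<Sum>q\<in>U. c p q * h p q) = int l * a" if "p \<in> B" for p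
    using that c[of p] diag[of p] zero[of p] by (simp add: split card a_def)
  have rC: "(\<Sum>q\<in>U. c p q * h p q) = - int s * b" if "p \<in> C" for p
    using that c'[of p] off[of p] zero[of p] by (simp add: split card b_def)
  have rD: "(\<Sum>q\<in>U. c p q * h p q) = - int s * b" if "p \<in> D" for p
    using that c'[of p] off[of p] zero[of p] by (simp add: split card b_def)
  have "hkernel (Suc k) U S T = (\<Sum>p\<in>U. \<Sum>q\<in>U. c p q * h p q)"
    by (simp add: c_def h_def)
  also have "\<dots> = int l * (int m * a) + int m * (int l * a) - int s * (int s * b) - int s * (int s * b)"
    by (subst split) (simp add: rA rB rC rD card)
  also have "\<dots> = 2 ^ Suc k * hahn (Suc k) (int l) (int m) (int s)"
    by (simp add: a_def b_def algebra_simps power2_eq_square)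
  finally show ?case .
qed

section \<open>Positive semidefiniteness of the kernels\<close>

definition qform :: "nat set set \<Rightarrow> nat \<Rightarrow> nat set \<Rightarrow> (nat set \<Rightarrow> int) \<Rightarrow> int" where
  "qform F k U v = (\<Sum>S\<in>F. \<Sum>T\<in>F. v S * v T * hkernel k U S T)"

lemma qform_0: "qform F 0 U v = (\<Sum>S\<in>F. v S)\<^sup>2"
  by (simp add: qform_def power2_eq_square sum_product)

text \<open>The product of the two differences splits, and each factor joins the weight of its own
  set. Unfolding down to degree 0 thus yields a sum of squares, which gives nonnegativity, and gives
  zero once every squared sum vanishes.\<close>

lemma qform_Suc:
  "qform F (Suc k) U v = (\<Sum>p\<in>U. \<Sum>q\<in>U. qform F k (U - {p, q}) (\<lambda>S. v S * (chi S p - chi S q)))"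
proof -
  have "qform F (Suc k) U v = (\<Sum>S\<in>F. \<Sum>T\<in>F. \<Sum>p\<in>U. \<Sum>q\<in>U.
     (v S * (chi S p - chi S q)) * (v T * (chi T p - chi T q)) * hkernel k (U - {p, q}) S T)"
    by (simp add: qform_def sum_distrib_left algebra_simps)
  also have "\<dots> = (\<Sum>S\<in>F. \<Sum>p\<in>U. \<Sum>T\<in>F. \<Sum>q\<in>U.
     (v S * (chi S p - chi S q)) * (v T * (chi T p - chi T q)) * hkernel k (U - {p, q}) S T)"
    by (intro sum.cong refl sum.swap)
  also have "\<dots> = (\<Sum>S\<in>F. \<Sum>p\<in>U. \<Sum>q\<in>U. \<Sum>T\<in>F.
     (v S * (chi S p - chi S q)) * (v T * (chi T p - chi T q)) * hkernel k (U - {p, q}) S T)"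
    by (intro sum.cong refl sum.swap)
  also have "\<dots> = (\<Sum>p\<in>U. \<Sum>S\<in>F. \<Sum>q\<in>U. \<Sum>T\<in>F.
     (v S * (chi S p - chi S q)) * (v T * (chi T p - chi T q)) * hkernel k (U - {p, q}) S T)"
    by (rule sum.swap)
  also have "\<dots> = (\<Sum>p\<in>U. \<Sum>q\<in>U. \<Sum>S\<in>F. \<Sum>T\<in>F.
     (v S * (chi S p - chi S q)) * (v T * (chi T p - chi T q)) * hkernel k (U - {p, q}) S T)"
    by (intro sum.cong refl sum.swap)
  finally show ?thesis by (simp add: qform_def)
qed

lemma qform_nonneg: "0 \<le> qform F k U v"
proof (induction k arbitrary: U v)
  case 0
  then show ?case by (simp add: qform_0)
next
  case (Suc k)
  then show ?case by (simp add: qform_Suc sum_nonneg)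
qed

text \<open>The parameters are the numbers of ones and of zeros, not length and weight, because
  common ones and common zeros are later added independently.\<close>

definition uniform_family :: "nat \<Rightarrow> nat \<Rightarrow> nat set set \<Rightarrow> bool" where
  "uniform_family a b F \<longleftrightarrow> (\<forall>S\<in>F. S \<subseteq> {..<a + b} \<and> card S = a)"

lemma uniform_family_finite: "uniform_family a b F \<Longrightarrow> finite F"
  by (rule finite_subset[of _ "Pow {..<a + b}"]) (auto simp: uniform_family_def)

lemma uniform_family_counts:
  assumes "uniform_family a b F" "S \<in> F" "T \<in> F"
  shows "card (S - T) \<le> a" "card (S - T) \<le> b"
    "card ({..<a + b} \<inter> S \<inter> T) = a - card (S - T)"
    "card ({..<a + b} - S - T) = b - card (S - T)"
    "card ({..<a + b} \<inter> S - T) = card (S - T)"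
    "card ({..<a + b} \<inter> T - S) = card (S - T)"
    "card (S \<inter> T) = a - card (S - T)"
proof -
  have S: "S \<subseteq> {..<a + b}" "card S = a" "finite S" and T: "T \<subseteq> {..<a + b}" "card T = a" "finite T"
    using assms by (auto simp: uniform_family_def intro: finite_subset)
  have 1: "card (S - T) + card (S \<inter> T) = a"
    using S card_Diff_subset_Int[of S T] card_mono[of S "S \<inter> T"] by auto
  have 2: "card (T - S) + card (S \<inter> T) = a"
    using S T card_Diff_subset_Int[of T S] card_mono[of T "S \<inter> T"] by (auto simp: Int_commute)
  have 3: "card (S \<union> T) = a + card (S - T)"
    using card_Un_Int[of S T] S T 1 by simp
  have "card (S \<union> T) \<le> a + b" using card_mono[of "{..<a + b}" "S \<union> T"] S T by auto
  then show "card (S - T) \<le> b" using 3 by simp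
  show "card (S - T) \<le> a" using 1 by simp
  show 4: "card (S \<inter> T) = a - card (S - T)" using 1 by simp
  have "{..<a + b} - S - T = {..<a + b} - (S \<union> T)" by auto
  then show "card ({..<a + b} - S - T) = b - card (S - T)"
    using card_Diff_subset[of "S \<union> T" "{..<a + b}"] S T 3 by simp
  show "card ({..<a + b} \<inter> S \<inter> T) = a - card (S - T)"
    using S 4 by (simp add: Int_absorb1)
  show "card ({..<a + b} \<inter> S - T) = card (S - T)" using S by (simp add: Int_absorb1)
  show "card ({..<a + b} \<inter> T - S) = card (S - T)" using T 1 2 by (simp add: Int_absorb1)
qed

lemma hkernel_uniform_family:
  assumes "uniform_family a b F" "S \<in> F" "T \<in> F" "d = int (card (S - T))"
  shows "hkernel k {..<a + b} S T = 2 ^ k * hahn k (int a - d) (int b - d) d"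
  using hkernel_eq_hahn[of "{..<a + b}" S T "a - card (S - T)" "b - card (S - T)" "card (S - T)" k]
    uniform_family_counts[OF assms(1-3)] assms(4) by (simp add: of_nat_diff)

lemma qform_uniform_family:
  assumes "uniform_family a b F"
  shows "qform F k {..<a + b} v = 2 ^ k * (\<Sum>S\<in>F. \<Sum>T\<in>F. v S * v T *
     hahn k (int a - int (card (S - T))) (int b - int (card (S - T))) (int (card (S - T))))"
  unfolding qform_def sum_distrib_left
  by (intro sum.cong refl) (simp add: hkernel_uniform_family[OF assms _ _ refl])

text \<open>Delsarte's inequalities with arbitrary weights. The linear programming bound takes all
  weights 1; the harmonic bound needs the general form in degree 2.\<close>

lemma hahn_form_nonneg:
  assumes "uniform_family a b F"
  shows "0 \<le> (\<Sum>S\<in>F. \<Sum>T\<in>F. v S * v T *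
     hahn k (int a - int (card (S - T))) (int b - int (card (S - T))) (int (card (S - T))))"
  using qform_nonneg[of F k "{..<a + b}" v] by (simp add: qform_uniform_family[OF assms] zero_le_mult_iff)

section \<open>Delsarte's linear programming bound\<close>

definition distance_bound :: "nat \<Rightarrow> nat \<Rightarrow> nat set \<Rightarrow> nat \<Rightarrow> bool" where
  "distance_bound a b D M \<longleftrightarrow> (\<forall>F. uniform_family a b F \<and>
     (\<forall>S\<in>F. \<forall>T\<in>F. S \<noteq> T \<longrightarrow> card (S - T) \<in> D) \<longrightarrow> card F \<le> M)"

definition lp_poly :: "int \<Rightarrow> int \<Rightarrow> int \<Rightarrow> (nat \<times> int) list \<Rightarrow> int \<Rightarrow> int" where
  "lp_poly a b c cs d = c + (\<Sum>(k, e)\<leftarrow>cs. e * hahn k (a - d) (b - d) d)"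

text \<open>The sum of the polynomial over all pairs from \<open>F\<close> is at least
  \<open>c\<close> times the square of \<open>card F\<close>, since the terms in \<open>cs\<close>
  contribute nonnegatively, and at most \<open>card F\<close> times the value at 0, since pairs of
  distinct sets contribute nonpositively. The strict comparison with \<open>c * (M + 1)\<close>
  builds in rounding down to an integer.\<close>

lemma linear_programming_bound:
  assumes c: "c > 0" "\<And>k e. (k, e) \<in> set cs \<Longrightarrow> 0 \<le> e"
    and D: "\<And>d. d \<in> D \<Longrightarrow> lp_poly (int a) (int b) c cs (int d) \<le> 0"
    and M: "lp_poly (int a) (int b) c cs 0 < c * (int M + 1)"
  shows "distance_bound a b D M"
  unfolding distance_bound_def
proof (intro allI impI)
  fix F assume "uniform_family a b F \<and> (\<forall>S\<in>F. \<forall>T\<in>F. S \<noteq> T \<longrightarrow> card (S - T) \<in> D)"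
  then have F: "uniform_family a b F" and FD: "\<And>S T. S \<in> F \<Longrightarrow> T \<in> F \<Longrightarrow> S \<noteq> T \<Longrightarrow> card (S - T) \<in> D"
    by auto
  have fin: "finite F" by (rule uniform_family_finite[OF F])
  define E where "E k d = hahn k (int a - d) (int b - d) d" for k d
  let ?d = "\<lambda>S T :: nat set. int (card (S - T))"
  let ?G = "lp_poly (int a) (int b) c cs"
  have nonneg: "0 \<le> (\<Sum>S\<in>F. \<Sum>T\<in>F. E k (?d S T))" for k
    using hahn_form_nonneg[OF F, of "\<lambda>_. 1"] by (simp add: E_def)
  have "0 \<le> (\<Sum>S\<in>F. \<Sum>T\<in>F. \<Sum>(k, e)\<leftarrow>cs. e * E k (?d S T))"
    using c(2)
  proof (induction cs)
    case (Cons ke cs)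
    obtain k e where ke: "ke = (k, e)" by force
    have "0 \<le> e * (\<Sum>S\<in>F. \<Sum>T\<in>F. E k (?d S T))"
      using Cons.prems[of k e] nonneg ke by simp
    moreover have "0 \<le> (\<Sum>S\<in>F. \<Sum>T\<in>F. \<Sum>(k, e)\<leftarrow>cs. e * E k (?d S T))"
      using Cons.prems by (intro Cons.IH) auto
    ultimately show ?case by (simp add: ke sum.distrib sum_distrib_left)
  qed simp
  then have "c * (int (card F))\<^sup>2
      \<le> c * (int (card F))\<^sup>2 + (\<Sum>S\<in>F. \<Sum>T\<in>F. \<Sum>(k, e)\<leftarrow>cs. e * E k (?d S T))" by simp
  also have "\<dots> = (\<Sum>S\<in>F. \<Sum>T\<in>F. ?G (?d S T))"
    by (simp add: lp_poly_def E_def sum.distrib power2_eq_square)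
  also have "\<dots> \<le> (\<Sum>S\<in>F. \<Sum>T\<in>F. if S = T then ?G 0 else 0)"
    using FD D by (intro sum_mono) auto
  also have "\<dots> = int (card F) * ?G 0" using fin by simp
  finally have le: "c * (int (card F))\<^sup>2 \<le> int (card F) * ?G 0" .
  show "card F \<le> M"
  proof (rule ccontr)
    assume "\<not> card F \<le> M"
    then have pos: "0 < int (card F)" and "int M + 1 \<le> int (card F)" by auto
    then have "?G 0 < c * int (card F)"
      using M c(1) mult_left_mono[of "int M + 1" "int (card F)" c] by linarith
    then have "int (card F) * ?G 0 < int (card F) * (c * int (card F))"
      using pos by (intro mult_strict_left_mono)
    then show False using le by (simp add: power2_eq_square algebra_simps)
  qed
qed

text \<open>Padding all sets with the same new ones and zeros changes no difference
  \<open>S - T\<close>, so a bound for larger parameters applies to smaller ones.\<close>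

lemma distance_bound_mono:
  assumes "distance_bound a' b' D' M'" "a \<le> a'" "b \<le> b'" "D \<subseteq> D'" "M' \<le> M"
  shows "distance_bound a b D M"
  unfolding distance_bound_def
proof (intro allI impI)
  fix F assume "uniform_family a b F \<and> (\<forall>S\<in>F. \<forall>T\<in>F. S \<noteq> T \<longrightarrow> card (S - T) \<in> D)"
  then have F: "uniform_family a b F" and FD: "\<And>S T. S \<in> F \<Longrightarrow> T \<in> F \<Longrightarrow> S \<noteq> T \<Longrightarrow> card (S - T) \<in> D"
    by auto
  \<comment> \<open>These \<open>a' - a\<close> new points join every set; the remaining
    \<open>b' - b\<close> new points of the ground set stay outside all of them.\<close>
  define Z where "Z = {a + b..<a' + b}"
  have disj: "S \<inter> Z = {}" if "S \<in> F" for S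
    using that F by (force simp: uniform_family_def Z_def)
  have inj: "inj_on (\<lambda>S. S \<union> Z) F"
    using disj by (intro inj_onI) (metis Diff_triv Int_commute Un_Diff Diff_cancel Un_empty_right)
  have "uniform_family a' b' ((\<lambda>S. S \<union> Z) ` F)"
    unfolding uniform_family_def
  proof
    fix R assume "R \<in> (\<lambda>S. S \<union> Z) ` F"
    then obtain S where S: "S \<in> F" "R = S \<union> Z" by auto
    have "S \<subseteq> {..<a + b}" "card S = a" using S F by (auto simp: uniform_family_def)
    moreover from this have "finite S" by (auto intro: finite_subset)
    moreover have "card R = card S + card Z"
      using S disj[OF S(1)] \<open>finite S\<close> by (simp add: card_Un_disjoint Z_def)
    ultimately show "R \<subseteq> {..<a' + b'} \<and> card R = a'"
      using assms(2,3) S by (auto simp: Z_def)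
  qed
  moreover have "\<forall>R\<in>(\<lambda>S. S \<union> Z) ` F. \<forall>Q\<in>(\<lambda>S. S \<union> Z) ` F. R \<noteq> Q \<longrightarrow> card (R - Q) \<in> D'"
  proof (intro ballI impI)
    fix R Q assume "R \<in> (\<lambda>S. S \<union> Z) ` F" "Q \<in> (\<lambda>S. S \<union> Z) ` F" and ne: "R \<noteq> Q"
    then obtain S T where ST: "S \<in> F" "T \<in> F" "R = S \<union> Z" "Q = T \<union> Z" by auto
    have "R - Q = S - T" using ST disj[of S] by auto
    then show "card (R - Q) \<in> D'" using FD[of S T] assms(4) ST ne by auto
  qed
  ultimately have "card ((\<lambda>S. S \<union> Z) ` F) \<le> M'"
    using assms(1) unfolding distance_bound_def by blast
  then show "card F \<le> M" using assms(5) card_image[OF inj] by simp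
qed

section \<open>Integrality of the distance ratios\<close>

lemma card_Int_eq_sum_chi:
  assumes "S \<subseteq> {..<n}"
  shows "int (card (S \<inter> T)) = (\<Sum>i<n. chi S i * chi T i)"
proof -
  have "(\<Sum>i<n. chi S i * chi T i) = (\<Sum>i<n. of_bool (i \<in> S \<inter> T))"
    by (intro sum.cong) (auto simp: chi_def)
  also have "\<dots> = int (card ({..<n} \<inter> (S \<inter> T)))" 
    by (simp add: of_bool_def sum.If_cases Int_def)
  also have "{..<n} \<inter> (S \<inter> T) = S \<inter> T" using assms by auto
  finally show ?thesis by simp
qed

lemma card_eq_sum_chi: "S \<subseteq> {..<n} \<Longrightarrow> int (card S) = (\<Sum>i<n. chi S i)"
  using card_Int_eq_sum_chi[of S n S] by (simp add: chi_def flip: of_bool_conj)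

lemma distance_eq_sum_chi:
  assumes "uniform_family a b F" "S \<in> F" "T \<in> F"
  shows "int (card (S - T)) = int a - (\<Sum>i<a + b. chi S i * chi T i)"
  using card_Int_eq_sum_chi[of S "a + b" T] uniform_family_counts(1,7)[OF assms] assms
  by (auto simp: uniform_family_def)

text \<open>Infinite descent: a rational eigenvalue of an integral matrix is an integer.\<close>

lemma dvd_of_integral_eigenvector:
  fixes P Q :: int and v :: "'a \<Rightarrow> int"
  assumes fin: "finite F" and Q: "Q \<noteq> 0"
    and eig: "\<And>T. T \<in> F \<Longrightarrow> P * v T = Q * (\<Sum>S\<in>F. A S T * v S)"
    and nz: "\<exists>T\<in>F. v T \<noteq> 0"
  shows "Q dvd P"
  using eig nz
proof (induction "\<Sum>T\<in>F. nat \<bar>v T\<bar>" arbitrary: v rule: less_induct)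
  case less
  define g where "g = gcd P Q"
  have g: "g > 0" using Q by (simp add: g_def)
  obtain P' Q' where PQ: "P = g * P'" "Q = g * Q'"
    by (metis g_def gcd_dvd1 gcd_dvd2 dvd_def)
  have cop: "coprime P' Q'"
    using gcd_mult_distrib_int[of g P' Q'] g PQ by (metis coprime_iff_gcd_eq_1 g_def abs_of_pos mult_cancel_left mult.right_neutral less_irrefl)
  have eq: "P' * v T = Q' * (\<Sum>S\<in>F. A S T * v S)" if "T \<in> F" for T
    using less.prems(1)[OF that] g PQ by (simp add: mult.assoc)
  \<comment> \<open>Since \<open>P'\<close> and \<open>Q'\<close> are coprime, \<open>Q'\<close>
    divides every entry; unless it is a unit, dividing by it produces a smaller nonzero
    eigenvector.\<close>
  have dvd: "Q' dvd v T" if "T \<in> F" for T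
    using eq[OF that] cop by (metis coprime_commute coprime_dvd_mult_right_iff dvd_triv_left)
  show ?case
  proof (cases "\<bar>Q'\<bar> = 1")
    case True
    then have "Q' dvd P'" by (metis abs_dvd_iff one_dvd)
    then show ?thesis by (simp add: PQ)
  next
    case False
    have Q': "\<bar>Q'\<bar> \<ge> 2" using False Q PQ by auto
    define u where "u T = v T div Q'" for T
    have u: "v T = Q' * u T" if "T \<in> F" for T using dvd[OF that] by (simp add: u_def)
    have "P * u T = Q * (\<Sum>S\<in>F. A S T * u S)" if "T \<in> F" for T
    proof -
      have "Q' * (P * u T) = Q * (\<Sum>S\<in>F. A S T * v S)"
        using less.prems(1)[OF that] u[OF that] by (simp add: mult.left_commute)
      also have "(\<Sum>S\<in>F. A S T * v S) = (\<Sum>S\<in>F. Q' * (A S T * u S))"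
        by (intro sum.cong) (auto simp: u)
      also have "\<dots> = Q' * (\<Sum>S\<in>F. A S T * u S)" by (simp add: sum_distrib_left)
      finally show ?thesis using Q' by auto
    qed
    moreover obtain Z where Z: "Z \<in> F" "v Z \<noteq> 0" using less.prems(2) by auto
    have "\<exists>T\<in>F. u T \<noteq> 0" using Z u by force
    moreover have "(\<Sum>T\<in>F. nat \<bar>u T\<bar>) < (\<Sum>T\<in>F. nat \<bar>v T\<bar>)"
    proof (rule sum_strict_mono_ex1[OF fin])
      have *: "\<bar>u T\<bar> * 2 \<le> \<bar>v T\<bar>" if "T \<in> F" for T
        using mult_left_mono[OF Q', of "\<bar>u T\<bar>"] u[OF that] by (simp add: abs_mult mult.commute)
      show "\<forall>T\<in>F. nat \<bar>u T\<bar> \<le> nat \<bar>v T\<bar>" using * by force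
      show "\<exists>T\<in>F. nat \<bar>u T\<bar> < nat \<bar>v T\<bar>" using * Z by force
    qed
    ultimately show ?thesis using less.hyps by blast
  qed
qed

text \<open>Every set has exactly \<open>a\<close> points, so the first moments add up to
  \<open>a\<close> times the total weight.\<close>

lemma sum_weights_eq_0:
  assumes F: "uniform_family a b F" and a: "0 < a"
    and v: "\<And>p. p < a + b \<Longrightarrow> (\<Sum>S\<in>F. v S * chi S p) = 0"
  shows "(\<Sum>S\<in>F. v S) = 0"
proof -
  have "int a * (\<Sum>S\<in>F. v S) = (\<Sum>S\<in>F. v S * int (card S))"
    using F by (simp add: sum_distrib_left uniform_family_def mult.commute)
  also have "\<dots> = (\<Sum>S\<in>F. v S * (\<Sum>p<a + b. chi S p))"
    using F by (intro sum.cong refl arg_cong2[where f = "(*)"] card_eq_sum_chi) (auto simp: uniform_family_def)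
  also have "\<dots> = (\<Sum>p<a + b. \<Sum>S\<in>F. v S * chi S p)"
    by (simp add: sum_distrib_left) (rule sum.swap)
  also have "\<dots> = 0" using v by simp
  finally show ?thesis using a by simp
qed

text \<open>The polynomial \<open>(y - d) * (z - d)\<close> vanishes at \<open>y\<close> and
  \<open>z\<close>, so only the diagonal and the pairs at distance \<open>x\<close> survive when the
  weights annihilate it; this is the eigenvalue equation. Each of the three distances later takes
  the role of \<open>x\<close>.\<close>

lemma distance_dvd:
  fixes x y z :: int
  assumes F: "uniform_family a b F" and a: "2 \<le> a"
    and dist: "\<And>S T. S \<in> F \<Longrightarrow> T \<in> F \<Longrightarrow> S \<noteq> T \<Longrightarrow> int (card (S - T)) \<in> {x, y, z}"
    and ne: "x \<noteq> y" "x \<noteq> z" and large: "(a + b) choose 2 < card F"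
  shows "(y - x) * (z - x) dvd y * z"
proof -
  let ?n = "a + b"
  have fin: "finite F" by (rule uniform_family_finite[OF F])
  define B where "B = {Y. Y \<subseteq> {..<?n} \<and> card Y = 2}"
  have B: "finite B" "card B = ?n choose 2"
    using n_subsets[of "{..<?n}" 2] by (auto simp: B_def)
  obtain v where v: "\<exists>S\<in>F. v S \<noteq> (0::int)" "\<And>Y. Y \<in> B \<Longrightarrow> (\<Sum>S\<in>F. v S * of_bool (Y \<subseteq> S)) = 0"
    using exists_nonzero_int_solution[OF B(1) fin, of "\<lambda>S Y. of_bool (Y \<subseteq> S)"] large B(2) by auto
  have v2: "(\<Sum>S\<in>F. v S * (chi S p * chi S q)) = 0" if "p < ?n" "q < ?n" "p \<noteq> q" for p q
  proof -
    have "{p, q} \<in> B" using that by (auto simp: B_def)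
    moreover have "of_bool ({p, q} \<subseteq> S) = chi S p * chi S q" for S by (simp add: chi_def)
    ultimately show ?thesis using v(2)[of "{p, q}"] by simp
  qed
  \<comment> \<open>First moments follow from second moments: summing over \<open>q\<close>
    different from \<open>p\<close> counts each set containing \<open>p\<close> exactly
    \<open>a - 1\<close> times.\<close>
  have v1: "(\<Sum>S\<in>F. v S * chi S p) = 0" if p: "p < ?n" for p
  proof -
    have "(int a - 1) * (\<Sum>S\<in>F. v S * chi S p) = (\<Sum>S\<in>F. (int a - 1) * (v S * chi S p))"
      by (rule sum_distrib_left)
    also have "\<dots> = (\<Sum>S\<in>F. v S * (chi S p * (\<Sum>q\<in>{..<?n} - {p}. chi S q)))"
    proof (intro sum.cong refl)
      fix S assume "S \<in> F"
      then have "int a = (\<Sum>q<?n. chi S q)" using F by (metis card_eq_sum_chi uniform_family_def)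
      also have "\<dots> = chi S p + (\<Sum>q\<in>{..<?n} - {p}. chi S q)"
        using p by (subst sum.remove[of _ p]) auto
      finally have *: "(\<Sum>q\<in>{..<?n} - {p}. chi S q) = int a - chi S p" by simp
      show "(int a - 1) * (v S * chi S p) = v S * (chi S p * (\<Sum>q\<in>{..<?n} - {p}. chi S q))"
        unfolding * by (simp add: chi_def)
    qed
    also have "\<dots> = (\<Sum>q\<in>{..<?n} - {p}. \<Sum>S\<in>F. v S * (chi S p * chi S q))"
      by (simp add: sum_distrib_left) (rule sum.swap)
    also have "\<dots> = 0" using v2 p by (intro sum.neutral) auto
    finally show ?thesis using a by simp
  qed
  have v0: "(\<Sum>S\<in>F. v S) = 0" by (rule sum_weights_eq_0[OF F _ v1]) (use a in auto)
  have lin: "(\<Sum>S\<in>F. v S * (\<Sum>i<?n. chi S i * chi T i)) = 0" for T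
  proof -
    have "(\<Sum>S\<in>F. v S * (\<Sum>i<?n. chi S i * chi T i)) = (\<Sum>i<?n. (\<Sum>S\<in>F. v S * chi S i) * chi T i)"
      by (simp add: sum_distrib_left sum_distrib_right algebra_simps) (rule sum.swap)
    then show ?thesis using v1 by simp
  qed
  \<comment> \<open>The squared inner product expands into second moments; its diagonal terms reduce
    to first moments because \<open>chi\<close> is idempotent.\<close>
  have quad: "(\<Sum>S\<in>F. v S * (\<Sum>i<?n. chi S i * chi T i)\<^sup>2) = 0" for T
  proof -
    have "(\<Sum>S\<in>F. v S * (\<Sum>i<?n. chi S i * chi T i)\<^sup>2)
       = (\<Sum>S\<in>F. \<Sum>i<?n. \<Sum>j<?n. (v S * (chi S i * chi S j)) * (chi T i * chi T j))"
      by (simp add: power2_eq_square sum_product sum_distrib_left algebra_simps)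
    also have "\<dots> = (\<Sum>i<?n. \<Sum>S\<in>F. \<Sum>j<?n. (v S * (chi S i * chi S j)) * (chi T i * chi T j))"
      by (rule sum.swap)
    also have "\<dots> = (\<Sum>i<?n. \<Sum>j<?n. \<Sum>S\<in>F. (v S * (chi S i * chi S j)) * (chi T i * chi T j))"
      by (intro sum.cong refl sum.swap)
    also have "\<dots> = (\<Sum>i<?n. \<Sum>j<?n. (\<Sum>S\<in>F. v S * (chi S i * chi S j)) * (chi T i * chi T j))"
      by (simp add: sum_distrib_right)
    also have "\<dots> = 0"
    proof (intro sum.neutral ballI)
      fix i j assume ij: "i \<in> {..<?n}" "j \<in> {..<?n}"
      show "(\<Sum>S\<in>F. v S * (chi S i * chi S j)) * (chi T i * chi T j) = 0"
      proof (cases "i = j")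
        case True
        then have "(\<Sum>S\<in>F. v S * (chi S i * chi S j)) = (\<Sum>S\<in>F. v S * chi S i)"
          by (intro sum.cong) (auto simp: chi_def)
        then show ?thesis using v1[of i] ij by simp
      next
        case False
        then show ?thesis using v2[of i j] ij by simp
      qed
    qed
    finally show ?thesis .
  qed
  define g where "g d = (y - d) * (z - d)" for d :: int
  \<comment> \<open>The matrix is minus the adjacency matrix of the distance-\<open>x\<close> graph.
    The condition \<open>S \<noteq> T\<close> keeps its diagonal zero even for \<open>x = 0\<close>,
    a value that is not excluded here.\<close>
  have "y * z * v T = ((y - x) * (z - x)) * (\<Sum>S\<in>F. (if int (card (S - T)) = x \<and> S \<noteq> T then -1 else 0) * v S)"
    if T: "T \<in> F" for T
  proof -
    let ?s = "\<lambda>S. \<Sum>i<?n. chi S i * chi T i"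
    have "(\<Sum>S\<in>F. v S * g (int (card (S - T))))
      = (\<Sum>S\<in>F. v S * ((y - int a) * (z - int a)) + v S * ?s S * (y + z - 2 * int a) + v S * (?s S)\<^sup>2)"
      using T by (intro sum.cong refl)
        (simp add: g_def distance_eq_sum_chi[OF F] algebra_simps power2_eq_square)
    also have "\<dots> = (\<Sum>S\<in>F. v S) * ((y - int a) * (z - int a)) + (\<Sum>S\<in>F. v S * ?s S) * (y + z - 2 * int a)
        + (\<Sum>S\<in>F. v S * (?s S)\<^sup>2)"
      by (simp add: sum.distrib sum_distrib_right)
    also have "\<dots> = 0" by (simp add: v0 lin quad)
    finally have zero: "(\<Sum>S\<in>F. v S * g (int (card (S - T)))) = 0" .
    have "(\<Sum>S\<in>F. v S * g (int (card (S - T)))) = v T * g 0 + (\<Sum>S\<in>F - {T}. v S * g (int (card (S - T))))"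
      using fin T by (subst sum.remove[of _ T]) auto
    also have "(\<Sum>S\<in>F - {T}. v S * g (int (card (S - T))))
        = (\<Sum>S\<in>F - {T}. - g x * ((if int (card (S - T)) = x \<and> S \<noteq> T then -1 else 0) * v S))"
    proof (intro sum.cong refl)
      fix S assume S: "S \<in> F - {T}"
      then have "int (card (S - T)) \<in> {x, y, z}" using dist T by auto
      then show "v S * g (int (card (S - T))) = - g x * ((if int (card (S - T)) = x \<and> S \<noteq> T then -1 else 0) * v S)"
        using S by (auto simp: g_def)
    qed
    also have "\<dots> = - g x * (\<Sum>S\<in>F - {T}. (if int (card (S - T)) = x \<and> S \<noteq> T then -1 else 0) * v S)"
      by (simp only: sum_distrib_left)
    also have "(\<Sum>S\<in>F - {T}. (if int (card (S - T)) = x \<and> S \<noteq> T then -1 else 0) * v S)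
        = (\<Sum>S\<in>F. (if int (card (S - T)) = x \<and> S \<noteq> T then -1 else 0) * v S)"
      using fin by (intro sum.mono_neutral_left) auto
    finally show ?thesis using zero by (simp add: g_def algebra_simps)
  qed
  then show ?thesis
    by (rule dvd_of_integral_eigenvector[OF fin _ _ v(1), rotated]) (use ne in auto)
qed

section \<open>The harmonic bound\<close>

lemma hahn_2_3:
  "hahn 2 l m s = l * (l - 1) * m * (m - 1) - 2 * l * m * s\<^sup>2 + (s * (s - 1))\<^sup>2"
  "hahn 3 l m s = l * (l - 1) * (l - 2) * m * (m - 1) * (m - 2) - 3 * l * (l - 1) * m * (m - 1) * s\<^sup>2
     + 3 * l * m * (s * (s - 1))\<^sup>2 - (s * (s - 1) * (s - 2))\<^sup>2"
  by (simp_all add: numeral_2_eq_2 numeral_3_eq_3) (simp_all add: algebra_simps power2_eq_square)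

text \<open>For \<open>s = x + y + z\<close> the left side is a multiple of
  \<open>(x - d) * (y - d) * (z - d)\<close> up to terms of degree at most 1. Those terms are left
  existential because the weights will annihilate them; what matters is the sign of the coefficient
  of \<open>hahn 2\<close>. The factors on the left clear denominators.\<close>

lemma cubic_hahn_expansion:
  fixes A B s :: int
  defines "n \<equiv> A + B"
  shows "\<exists>\<gamma> \<delta>. \<forall>d. (n - 1) * (n - 2) * (n - 3) * (n - 4) * (s * d\<^sup>2 - d ^ 3)
    = (n - 1) * hahn 3 (A - d) (B - d) d
      + (n - 3) * ((s - 3) * (n - 4) - 3 * (A - 2) * (B - 2)) * hahn 2 (A - d) (B - d) d + \<gamma> * d + \<delta>"
proof -
  have 2: "hahn 2 (A - d) (B - d) d = (n - 1) * (n - 2) * d\<^sup>2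
    + ((A - 1) * (B - 1) * ((A - 2) * (B - 2) - 2 - A * B) - (n - 1) * (n - 2)) * d + A * B * (A - 1) * (B - 1)" for d
    unfolding hahn_2_3 n_def by algebra
  have 3: "hahn 3 (A - d) (B - d) d = - ((n - 2) * (n - 3) * (n - 4)) * d ^ 3
    + 3 * (n - 2) * (n - 3) * (n - 4 + (A - 2) * (B - 2)) * d\<^sup>2
    + ((A - 1) * (B - 1) * (A - 2) * (B - 2) * ((A - 3) * (B - 3) - 3 - A * B)
        + (n - 2) * (n - 3) * (n - 4) - 3 * (n - 2) * (n - 3) * (n - 4 + (A - 2) * (B - 2))) * d
    + A * (A - 1) * (A - 2) * B * (B - 1) * (B - 2)" for d
    unfolding hahn_2_3 n_def by algebra
  define \<beta> where "\<beta> = (n - 3) * ((s - 3) * (n - 4) - 3 * (A - 2) * (B - 2))"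
  define p where "p = ((A - 1) * (B - 1) * ((A - 2) * (B - 2) - 2 - A * B) - (n - 1) * (n - 2))"
  define q where "q = ((A - 1) * (B - 1) * (A - 2) * (B - 2) * ((A - 3) * (B - 3) - 3 - A * B)
        + (n - 2) * (n - 3) * (n - 4) - 3 * (n - 2) * (n - 3) * (n - 4 + (A - 2) * (B - 2)))"
  \<comment> \<open>This compares the coefficients of \<open>d\<^sup>2\<close>. Those of the cube
    agree by inspection, and \<open>\<gamma>\<close> and \<open>\<delta>\<close> absorb the lower
    degrees.\<close>
  have "(n - 1) * (n - 2) * (n - 3) * (n - 4) * s = (n - 1) * (3 * (n - 2) * (n - 3) * (n - 4 + (A - 2) * (B - 2)))
     + \<beta> * ((n - 1) * (n - 2))" unfolding \<beta>_def by algebra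
  then have "\<forall>d. (n - 1) * (n - 2) * (n - 3) * (n - 4) * (s * d\<^sup>2 - d ^ 3)
    = (n - 1) * hahn 3 (A - d) (B - d) d + \<beta> * hahn 2 (A - d) (B - d) d
      + (- ((n - 1) * q + \<beta> * p)) * d
      + (- ((n - 1) * (A * (A - 1) * (A - 2) * B * (B - 1) * (B - 2)) + \<beta> * (A * B * (A - 1) * (B - 1))))"
    unfolding 2 3 p_def[symmetric] q_def[symmetric] by algebra
  then show ?thesis unfolding \<beta>_def by blast
qed

text \<open>Combining the four triples inside \<open>{p, q, r, s}\<close> shows that
  \<open>u\<close> agrees on complementary pairs. With five points, all three pairs inside
  \<open>{p, q, r}\<close> are disjoint from a common pair, so their values are equal and sum to
  0.\<close>

lemma triple_sum_injective:
  fixes u :: "nat set \<Rightarrow> int"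
  assumes n: "5 \<le> n"
    and u: "\<And>p q r. p < n \<Longrightarrow> q < n \<Longrightarrow> r < n \<Longrightarrow> distinct [p, q, r] \<Longrightarrow> u {p, q} + u {p, r} + u {q, r} = 0"
    and pq: "p < n" "q < n" "p \<noteq> q"
  shows "u {p, q} = 0"
proof -
  have disj: "u {p, q} = u {r, s}" if "p < n" "q < n" "r < n" "s < n" "distinct [p, q, r, s]" for p q r s
    using u[of p q r] u[of p q s] u[of p r s] u[of q r s] that by (simp add: insert_commute)
  have "card ({..<n} - {p, q}) \<ge> 3" using n pq by (simp add: card_Diff_subset)
  then obtain T where T: "T \<subseteq> {..<n} - {p, q}" "card T = 3" by (meson obtain_subset_with_card_n)
  then obtain r s t where rst: "T = {r, s, t}" "distinct [r, s, t]"
    by (auto simp: card_3_iff)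
  have "u {p, q} = u {s, t}" "u {p, r} = u {s, t}" "u {q, r} = u {s, t}"
    using T rst pq by (intro disj; auto)+
  then show ?thesis using u[of p q r] T rst pq by auto
qed

text \<open>The unknowns \<open>u\<close> indexed by pairs express that the weighting \<open>v\<close> annihilates the cubic harmonics: on triples its
  third moments are a sum over the pairs, and these cancel in a product of three differences.\<close>

lemma harmonic_bound:
  fixes x y z :: nat
  assumes F: "uniform_family a b F" and a: "0 < a" and n: "5 \<le> a + b"
    and dist: "\<And>S T. S \<in> F \<Longrightarrow> T \<in> F \<Longrightarrow> S \<noteq> T \<Longrightarrow> card (S - T) \<in> {x, y, z}"
    and pos: "0 < x" "0 < y" "0 < z"
    and mean: "(int (x + y + z) - 3) * (int (a + b) - 4) \<le> 3 * (int a - 2) * (int b - 2)"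
  shows "card F + ((a + b) choose 2) \<le> ((a + b) choose 3) + (a + b)"
proof (rule ccontr)
  assume neg: "\<not> ?thesis"
  let ?n = "a + b"
  have fin: "finite F" by (rule uniform_family_finite[OF F])
  define P where "P = {Y. Y \<subseteq> {..<?n} \<and> card Y = 2}"
  define Tr where "Tr = {Y. Y \<subseteq> {..<?n} \<and> card Y = 3}"
  define Si where "Si = {Y. Y \<subseteq> {..<?n} \<and> card Y = 1}"
  have cards: "finite P" "card P = ?n choose 2" "finite Tr" "card Tr = ?n choose 3" "finite Si" "card Si = ?n"
    using n_subsets[of "{..<?n}" 2] n_subsets[of "{..<?n}" 3] n_subsets[of "{..<?n}" 1]
    by (auto simp: P_def Tr_def Si_def)
  \<comment> \<open>Unknowns are a weight for each member of \<open>F\<close> and one for each pair;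
    equations belong to triples and singletons. A singleton contains no pair, so its equation
    annihilates a first moment. Failure of the claimed bound says exactly that there are more
    unknowns than equations.\<close>
  define M :: "nat set + nat set \<Rightarrow> nat set \<Rightarrow> int" where
    "M s Y = (case s of Inl S \<Rightarrow> of_bool (Y \<subseteq> S) | Inr Z \<Rightarrow> - of_bool (Z \<subseteq> Y))" for s Y
  have "card (F <+> P) = card F + (?n choose 2)"
    using fin cards by (simp add: card_Plus)
  moreover have "card (Tr \<union> Si) = (?n choose 3) + ?n"
    using cards by (subst card_Un_disjoint) (auto simp: Tr_def Si_def)
  ultimately have "card (Tr \<union> Si) < card (F <+> P)" using neg by simp
  then obtain h where h: "\<exists>s\<in>F <+> P. h s \<noteq> 0" "\<And>Y. Y \<in> Tr \<union> Si \<Longrightarrow> (\<Sum>s\<in>F <+> P. h s * M s Y) = 0"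
    using exists_nonzero_int_solution[of "Tr \<union> Si" "F <+> P" M] fin cards by auto
  define v where "v S = h (Inl S)" for S
  define u where "u Z = h (Inr Z)" for Z
  have eq: "(\<Sum>S\<in>F. v S * of_bool (Y \<subseteq> S)) = (\<Sum>Z\<in>P. u Z * of_bool (Z \<subseteq> Y))" if "Y \<in> Tr \<union> Si" for Y
    using h(2)[OF that] fin cards
    by (simp add: sum.Plus M_def v_def u_def sum_negf)
  have v1: "(\<Sum>S\<in>F. v S * chi S p) = 0" if "p < ?n" for p
  proof -
    have "\<not> Z \<subseteq> {p}" if "Z \<in> P" for Z
      using that card_mono[of "{p}" Z] by (auto simp: P_def)
    then have "(\<Sum>Z\<in>P. u Z * of_bool (Z \<subseteq> {p})) = 0" by simp
    then show ?thesis using eq[of "{p}"] that by (simp add: Si_def chi_def)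
  qed
  have v3: "(\<Sum>S\<in>F. v S * (chi S p * chi S q * chi S r)) = u {p, q} + u {p, r} + u {q, r}"
    if pqr: "p < ?n" "q < ?n" "r < ?n" "distinct [p, q, r]" for p q r
  proof -
    have Y: "{p, q, r} \<in> Tr" using pqr by (auto simp: Tr_def)
    have "(\<Sum>Z\<in>P. u Z * of_bool (Z \<subseteq> {p, q, r})) = (\<Sum>Z\<in>{{p, q}, {p, r}, {q, r}}. u Z)"
    proof (rule sum.mono_neutral_cong_right)
      show "{{p, q}, {p, r}, {q, r}} \<subseteq> P" using pqr by (auto simp: P_def)
      show "\<forall>Z\<in>P - {{p, q}, {p, r}, {q, r}}. u Z * of_bool (Z \<subseteq> {p, q, r}) = 0"
      proof
        fix Z assume Z: "Z \<in> P - {{p, q}, {p, r}, {q, r}}"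
        then obtain i j where "Z = {i, j}" "i \<noteq> j" by (auto simp: P_def card_2_iff)
        then show "u Z * of_bool (Z \<subseteq> {p, q, r}) = 0" using Z by (auto simp: doubleton_eq_iff)
      qed
    qed (use cards in auto)
    also have "\<dots> = u {p, q} + u {p, r} + u {q, r}"
      using pqr by (auto simp: doubleton_eq_iff)
    finally show ?thesis using eq[of "{p, q, r}"] Y by (simp add: chi_def flip: of_bool_conj)
  qed
  \<comment> \<open>If all weights on \<open>F\<close> vanished, the triple equations would force
    the pair unknowns to vanish as well, by \<open>triple_sum_injective\<close>.\<close>
  have nz: "\<exists>S\<in>F. v S \<noteq> 0"
  proof (rule ccontr)
    assume "\<not> ?thesis"
    then have "u {p, q} + u {p, r} + u {q, r} = 0" if "p < ?n" "q < ?n" "r < ?n" "distinct [p, q, r]" for p q r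
      using v3[OF that] by simp
    then have u0: "u {p, q} = 0" if "p < ?n" "q < ?n" "p \<noteq> q" for p q
      using that n by (intro triple_sum_injective[where n = ?n and u = u]) auto
    have "u Z = 0" if Z: "Z \<in> P" for Z
    proof -
      obtain i j where "Z = {i, j}" "i \<noteq> j" using Z by (auto simp: P_def card_2_iff)
      then show ?thesis using u0[of i j] Z by (auto simp: P_def)
    qed
    with \<open>\<not> (\<exists>S\<in>F. v S \<noteq> 0)\<close> h(1) show False by (auto simp: u_def v_def)
  qed
  have v0: "(\<Sum>S\<in>F. v S) = 0" by (rule sum_weights_eq_0[OF F a v1])
  \<comment> \<open>The product of three differences expands into eight third moments. Each pair
    unknown occurs in two of them, with opposite signs.\<close>
  have q3: "qform F 3 {..<?n} v = 0"
  proof -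
    have "(\<Sum>S\<in>F. v S * (chi S p - chi S q) * (chi S p' - chi S q') * (chi S p'' - chi S q'')) = 0"
      if "p < ?n" "q < ?n" "p' \<in> {..<?n} - {p, q}" "q' \<in> {..<?n} - {p, q}"
        "p'' \<in> {..<?n} - {p, q} - {p', q'}" "q'' \<in> {..<?n} - {p, q} - {p', q'}" for p q p' q' p'' q''
    proof -
      define m where "m i j k = (\<Sum>S\<in>F. v S * (chi S i * chi S j * chi S k))" for i j k
      have "(\<Sum>S\<in>F. v S * (chi S p - chi S q) * (chi S p' - chi S q') * (chi S p'' - chi S q''))
         = m p p' p'' - m q p' p'' - m p q' p'' + m q q' p'' - m p p' q'' + m q p' q'' + m p q' q'' - m q q' q''"
        by (simp add: m_def algebra_simps sum.distrib sum_subtractf)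
      also have "\<dots> = 0"
        using that unfolding m_def by (subst v3; (force | simp))+
      finally show ?thesis .
    qed
    then show ?thesis by (simp add: numeral_3_eq_3 qform_Suc qform_0)
  qed
  let ?d = "\<lambda>S T :: nat set. int (card (S - T))"
  define W where "W f = (\<Sum>S\<in>F. \<Sum>T\<in>F. v S * v T * f (?d S T))" for f :: "int \<Rightarrow> int"
  have W_add: "W (\<lambda>d. f d + g d) = W f + W g" and W_mult: "W (\<lambda>d. c * f d) = c * W f" for f g c
    by (simp_all add: W_def algebra_simps sum.distrib sum_distrib_left)
  have W_const: "W (\<lambda>_. c) = 0" for c
  proof -
    have "W (\<lambda>_. c) = c * (\<Sum>S\<in>F. v S)\<^sup>2"
      by (simp add: W_def power2_eq_square sum_product sum_distrib_left algebra_simps)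
    then show ?thesis using v0 by simp
  qed
  have W_lin: "W (\<lambda>d. d) = 0"
  proof -
    have "W (\<lambda>d. d) = (\<Sum>S\<in>F. \<Sum>T\<in>F. v S * v T * (int a - (\<Sum>i<?n. chi S i * chi T i)))"
      unfolding W_def by (intro sum.cong refl) (simp add: distance_eq_sum_chi[OF F])
    also have "\<dots> = (\<Sum>S\<in>F. v S * (int a * (\<Sum>T\<in>F. v T) - (\<Sum>i<?n. chi S i * (\<Sum>T\<in>F. v T * chi T i))))"
    proof (intro sum.cong refl)
      fix S
      have "(\<Sum>T\<in>F. v S * v T * (int a - (\<Sum>i<?n. chi S i * chi T i)))
        = v S * (int a * (\<Sum>T\<in>F. v T) - (\<Sum>T\<in>F. \<Sum>i<?n. chi S i * (v T * chi T i)))"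
        by (simp add: algebra_simps sum_subtractf sum_distrib_left)
      also have "(\<Sum>T\<in>F. \<Sum>i<?n. chi S i * (v T * chi T i)) = (\<Sum>i<?n. chi S i * (\<Sum>T\<in>F. v T * chi T i))"
        unfolding sum_distrib_left by (rule sum.swap)
      finally show "(\<Sum>T\<in>F. v S * v T * (int a - (\<Sum>i<?n. chi S i * chi T i)))
        = v S * (int a * (\<Sum>T\<in>F. v T) - (\<Sum>i<?n. chi S i * (\<Sum>T\<in>F. v T * chi T i)))" .
    qed
    also have "\<dots> = 0" using v0 v1 by simp
    finally show ?thesis .
  qed
  have W3: "W (\<lambda>d. hahn 3 (int a - d) (int b - d) d) = 0"
    using q3 by (simp add: qform_uniform_family[OF F] W_def)
  have W2: "W (\<lambda>d. hahn 2 (int a - d) (int b - d) d) \<ge> 0"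
    using hahn_form_nonneg[OF F, of v 2] by (simp add: W_def)
  define s where "s = int (x + y + z)"
  define N where "N = (int ?n - 1) * (int ?n - 2) * (int ?n - 3) * (int ?n - 4)"
  define \<beta> where "\<beta> = (int ?n - 3) * ((s - 3) * (int ?n - 4) - 3 * (int a - 2) * (int b - 2))"
  have N: "N > 0" using n by (simp add: N_def)
  have \<beta>: "\<beta> \<le> 0" using mean n by (simp add: \<beta>_def s_def mult_nonneg_nonpos)
  obtain \<gamma> \<delta> where exp: "\<And>d. N * (s * d\<^sup>2 - d ^ 3)
      = (int ?n - 1) * hahn 3 (int a - d) (int b - d) d + \<beta> * hahn 2 (int a - d) (int b - d) d + \<gamma> * d + \<delta>"
    using cubic_hahn_expansion[of "int a" "int b" s] unfolding N_def \<beta>_def by auto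
  \<comment> \<open>Since \<open>f\<close> vanishes at all three distances, \<open>W f\<close>
    reduces to \<open>f 0\<close> times a sum of squares and is positive, while the expansion makes
    it nonpositive.\<close>
  define f where "f d = (int x - d) * (int y - d) * (int z - d)" for d
  have "N * W f = W (\<lambda>d. N * f d)" by (simp add: W_mult)
  also have "(\<lambda>d. N * f d) = (\<lambda>d. N * (s * d\<^sup>2 - d ^ 3)
       + ((- N * (int x * int y + int x * int z + int y * int z)) * d + N * int x * int y * int z))"
    by (rule ext) (simp add: f_def s_def algebra_simps power2_eq_square power3_eq_cube)
  also have "W \<dots> = W (\<lambda>d. N * (s * d\<^sup>2 - d ^ 3))"
    by (simp only: W_add W_mult W_const W_lin mult_zero_right add_0_right)
  also have "\<dots> = (int ?n - 1) * W (\<lambda>d. hahn 3 (int a - d) (int b - d) d)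
      + \<beta> * W (\<lambda>d. hahn 2 (int a - d) (int b - d) d)"
    unfolding exp by (simp add: W_add W_mult W_const W_lin)
  also have "\<dots> \<le> 0" using W3 W2 \<beta> by (simp add: mult_nonpos_nonneg)
  finally have "W f \<le> 0" using N by (simp add: mult_le_0_iff)
  have "W f = (\<Sum>S\<in>F. \<Sum>T\<in>F. if S = T then (v S)\<^sup>2 * f 0 else 0)"
    unfolding W_def
  proof (intro sum.cong refl)
    fix S T assume ST: "S \<in> F" "T \<in> F"
    have "f (?d S T) = 0" if "S \<noteq> T" using dist[OF ST that] by (auto simp: f_def)
    then show "v S * v T * f (?d S T) = (if S = T then (v S)\<^sup>2 * f 0 else 0)"
      by (auto simp: power2_eq_square)
  qed
  also have "\<dots> = (\<Sum>S\<in>F. (v S)\<^sup>2) * f 0"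
    using fin by (simp add: sum_distrib_right)
  finally have "W f = (\<Sum>S\<in>F. (v S)\<^sup>2) * f 0" .
  moreover have "f 0 > 0" using pos by (simp add: f_def)
  moreover have "(\<Sum>S\<in>F. (v S)\<^sup>2) > 0"
    using nz fin by (metis (no_types, lifting) sum_pos2 zero_le_power2 zero_less_power2)
  ultimately have "W f > 0" by simp
  then show False using \<open>W f \<le> 0\<close> by simp
qed

section \<open>Certificates for the remaining parameters\<close>

fun double_falling :: "nat \<Rightarrow> int \<Rightarrow> int \<Rightarrow> int" where
  "double_falling 0 l m = 1"
| "double_falling (Suc j) l m = l * m * double_falling j (l - 1) (m - 1)"

text \<open>The defining recursion branches twice in each degree, hence is exponential to evaluate;
  this sum has only \<open>k + 1\<close> terms. The induction step is Pascal's rule.\<close>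

lemma hahn_eq_sum:
  "hahn k l m s = (\<Sum>i\<le>k. (-1) ^ i * int (k choose i) * double_falling (k - i) l m * double_falling i s s)"
proof (induction k arbitrary: l m s)
  case 0
  then show ?case by simp
next
  case (Suc k)
  define f where "f i = (-1) ^ i * double_falling (Suc k - i) l m * double_falling i s s" for i
  have 1: "l * m * hahn k (l - 1) (m - 1) s = (\<Sum>i\<le>k. int (k choose i) * f i)"
    unfolding Suc.IH sum_distrib_left f_def by (intro sum.cong refl) (simp add: Suc_diff_le algebra_simps)
  have 2: "s\<^sup>2 * hahn k l m (s - 1) = - (\<Sum>i\<le>k. int (k choose i) * f (Suc i))"
    unfolding Suc.IH sum_distrib_left sum_negf[symmetric] f_def
    by (intro sum.cong refl) (simp add: algebra_simps power2_eq_square)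
  have "(\<Sum>i\<le>Suc k. int (Suc k choose i) * f i)
      = (\<Sum>i\<le>k. int (k choose i) * f (Suc i)) + (f 0 + (\<Sum>i\<le>k. int (k choose Suc i) * f (Suc i)))"
    by (subst sum.atMost_Suc_shift) (simp add: algebra_simps sum.distrib)
  also have "f 0 + (\<Sum>i\<le>k. int (k choose Suc i) * f (Suc i)) = (\<Sum>i\<le>Suc k. int (k choose i) * f i)"
    by (subst sum.atMost_Suc_shift) simp
  also have "\<dots> = (\<Sum>i\<le>k. int (k choose i) * f i)"
    by (simp add: binomial_eq_0)
  finally have "hahn (Suc k) l m s = (\<Sum>i\<le>Suc k. int (Suc k choose i) * f i)"
    using 1 2 by simp
  then show ?case by (simp add: f_def mult_ac)
qed

text \<open>The coefficients of the \<open>k\<close>-th power of \<open>1 - t\<close>: multiplying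
  by \<open>1 - t\<close> subtracts the shifted list.\<close>

fun signed_binomials :: "nat \<Rightarrow> int list" where
  "signed_binomials 0 = [1]"
| "signed_binomials (Suc k) = map2 (-) (signed_binomials k @ [0]) (0 # signed_binomials k)"

text \<open>The accumulator \<open>r\<close> carries the product reached so far, so each entry is
  obtained from the preceding one.\<close>

fun double_fallings :: "nat \<Rightarrow> int \<Rightarrow> int \<Rightarrow> int \<Rightarrow> int list" where
  "double_fallings 0 r l m = [r]"
| "double_fallings (Suc j) r l m = r # double_fallings j (r * (l * m)) (l - 1) (m - 1)"

text \<open>Division-free, with a number of multiplications linear in the degree.\<close>

definition hahn_eval :: "nat \<Rightarrow> int \<Rightarrow> int \<Rightarrow> int \<Rightarrow> int" where
  "hahn_eval k l m s = sum_list (map2 (*) (signed_binomials k)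
     (map2 (*) (rev (double_fallings k 1 l m)) (double_fallings k 1 s s)))"

lemma signed_binomials: "signed_binomials k = map (\<lambda>i. (-1) ^ i * int (k choose i)) [0..<Suc k]"
proof (induction k)
  case (Suc k)
  show ?case
  proof (rule nth_equalityI)
    fix i assume "i < length (signed_binomials (Suc k))"
    then have "i < Suc (Suc k)" by (simp add: Suc.IH)
    then show "signed_binomials (Suc k) ! i = map (\<lambda>i. (-1) ^ i * int (Suc k choose i)) [0..<Suc (Suc k)] ! i"
      unfolding signed_binomials.simps Suc.IH
      by (cases i) (auto simp: nth_append nth_Cons' less_Suc_eq algebra_simps simp del: upt_Suc)
  qed (simp add: Suc.IH)
qed simp

lemma double_fallings: "double_fallings k r l m = map (\<lambda>j. r * double_falling j l m) [0..<Suc k]"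
proof (induction k arbitrary: r l m)
  case (Suc k)
  have "[0..<Suc (Suc k)] = 0 # map Suc [0..<Suc k]" by (simp add: map_Suc_upt upt_conv_Cons del: upt_Suc)
  then show ?case by (simp add: Suc.IH o_def mult_ac del: upt_Suc)
qed simp

lemma hahn_eval: "hahn_eval k l m s = hahn k l m s"
proof -
  have "hahn_eval k l m s = sum_list (map (\<lambda>i. (-1) ^ i * int (k choose i) * (double_falling (k - i) l m * double_falling i s s)) [0..<Suc k])"
    unfolding hahn_eval_def signed_binomials double_fallings
    by (intro arg_cong[of _ _ sum_list] nth_equalityI) (auto simp: rev_nth simp del: upt_Suc)
  then show ?thesis
    by (simp add: hahn_eq_sum interv_sum_list_conv_sum_set_nat atLeast0LessThan lessThan_Suc_atMost mult.assoc del: upt_Suc)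
qed

section \<open>Certificates, integral triples and the finite checks\<close>

type_synonym certificate = "int \<times> int \<times> int \<times> (nat \<times> int) list \<times> int"

fun lp_eval :: "int \<Rightarrow> int \<Rightarrow> int \<Rightarrow> (nat \<times> int) list \<Rightarrow> int \<Rightarrow> int" where
  "lp_eval a b c [] d = c"
| "lp_eval a b c ((k, e) # cs) d = e * hahn_eval k (a - d) (b - d) d + lp_eval a b c cs d"

lemma lp_eval: "lp_eval a b c cs d = lp_poly a b c cs d"
  by (induction cs) (auto simp: lp_poly_def hahn_eval)

text \<open>A certificate \<open>(a, b, c, cs, M)\<close> is a feasible solution of the dual linear program: it shows
  that a family of \<open>a\<close>-subsets of an \<open>(a + b)\<close>-set with distances \<open>x, y, z\<close> has at most \<open>M\<close> members.\<close>

fun valid_certificate :: "int \<Rightarrow> int \<Rightarrow> int \<Rightarrow> certificate \<Rightarrow> bool" where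
  "valid_certificate x y z (a, b, c, cs, M) \<longleftrightarrow>
     0 \<le> a \<and> 0 \<le> b \<and> 0 \<le> M \<and> 0 < c \<and> list_all (\<lambda>e. 0 \<le> e) (map snd cs)
     \<and> list_all (\<lambda>v. v \<le> 0) (map (lp_eval a b c cs) [x, y, z]) \<and> lp_eval a b c cs 0 < c * (M + 1)"

lemma valid_certificate_bound:
  assumes "valid_certificate (int x) (int y) (int z) (a, b, c, cs, M)"
  shows "distance_bound (nat a) (nat b) {x, y, z} (nat M)"
proof (rule linear_programming_bound[of c cs])
  show "0 \<le> e" if "(k, e) \<in> set cs" for k e
    using assms that by (force simp: list_all_iff)
qed (use assms in \<open>auto simp: lp_eval\<close>)

text \<open>The divisibility of \<open>distance_dvd\<close> for each of the three distances, in a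
  form suited to evaluation.\<close>

definition integral_triple :: "int \<Rightarrow> int \<Rightarrow> int \<Rightarrow> bool" where
  "integral_triple x y z \<longleftrightarrow> (y * z) mod ((y - x) * (z - x)) = 0 \<and> (x * z) mod ((x - y) * (z - y)) = 0
     \<and> (x * y) mod ((x - z) * (y - z)) = 0"

definition integral_triples_from :: "int \<Rightarrow> int \<Rightarrow> int \<Rightarrow> (int \<times> int \<times> int) list" where
  "integral_triples_from m x y = map (\<lambda>z. (x, y, z)) (filter (integral_triple x y) [y + 1..m])"

definition integral_triples :: "int \<Rightarrow> (int \<times> int \<times> int) list" where
  "integral_triples m = concat (map (\<lambda>x. concat (map (integral_triples_from m x) [x + 1..m])) [1..m])"

lemma in_integral_triples:
  assumes "0 < x" "x < y" "y < z" "z \<le> m" "integral_triple x y z"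
  shows "(x, y, z) \<in> set (integral_triples m)"
  using assms unfolding integral_triples_def integral_triples_from_def by force

fun box :: "certificate \<Rightarrow> int \<times> int \<times> int" where
  "box (a, b, c, cs, M) = (a, b, M)"

text \<open>By \<open>distance_bound_mono\<close> a certificate also serves smaller \<open>a\<close>
  and \<open>b\<close> and any larger target \<open>T\<close>, so only its box
  \<open>(a', b', M)\<close> has to be compared.\<close>

fun covered :: "(int \<times> int \<times> int) list \<Rightarrow> int \<Rightarrow> int \<Rightarrow> int \<Rightarrow> bool" where
  "covered [] a b T = False"
| "covered ((a', b', M) # R) a b T = (if a \<le> a' \<and> b \<le> b' \<and> M \<le> T then True else covered R a b T)"

lemma covered_bound:
  assumes "list_all (valid_certificate (int x) (int y) (int z)) C"
    and "covered (map box C) (int a) (int b) (int T)"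
  shows "distance_bound a b {x, y, z} T"
  using assms
proof (induction C)
  case (Cons cert C)
  obtain a' b' c cs M where cert: "cert = (a', b', c, cs, M)" by (cases cert) auto
  show ?case
  proof (cases "int a \<le> a' \<and> int b \<le> b' \<and> M \<le> int T")
    case True
    have "distance_bound (nat a') (nat b') {x, y, z} (nat M)"
      using Cons.prems(1) cert by (intro valid_certificate_bound) auto
    then show ?thesis by (rule distance_bound_mono) (use True in auto)
  next
    case False
    then show ?thesis using Cons cert by (auto split: if_splits)
  qed
qed simp

text \<open>The bound of part (1) without binomial coefficients; the division is exact at natural
  numbers, by \<open>three_distance_bound_eq\<close>.\<close>

definition three_distance_bound :: "int \<Rightarrow> int" where
  "three_distance_bound n = (n * (n - 1) * (n - 2) - 3 * n * (n - 1) + 6 * n) div 6"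

definition harmonic_case :: "int \<Rightarrow> int \<Rightarrow> int \<Rightarrow> bool" where
  "harmonic_case s n w \<longleftrightarrow> (s - 3) * (n - 4) \<le> 3 * (w - 2) * (n - w - 2)"

text \<open>Once \<^const>\<open>harmonic_case\<close> holds, it persists for larger weights.\<close>

fun scan_weights :: "int \<Rightarrow> int \<Rightarrow> (int \<times> int \<times> int) list \<Rightarrow> int \<Rightarrow> int \<Rightarrow> int list \<Rightarrow> bool" where
  "scan_weights x s R n T [] = True"
| "scan_weights x s R n T (w # ws) =
    (if harmonic_case s n w then True
     else if (if w * (n - w) < n * x then True else covered R w (n - w) T) then scan_weights x s R n T ws
     else False)"

text \<open>The three alternatives are the situations handled by \<open>harmonic_bound\<close>,
  \<open>first_moment_bound\<close> and \<open>covered_bound\<close>.\<close>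

lemma scan_weights:
  assumes "scan_weights x s R n T ws" "sorted ws" "\<forall>w\<in>set ws. 2 * w \<le> n" "w \<in> set ws"
  shows "harmonic_case s n w \<or> w * (n - w) < n * x \<or> covered R w (n - w) T"
  using assms
proof (induction ws)
  case (Cons v ws)
  show ?case
  proof (cases "harmonic_case s n v")
    case True
    have "v \<le> w" "2 * w \<le> n" "2 * v \<le> n" using Cons.prems by auto
    \<comment> \<open>This product is the increase of \<open>(w - 2) * (n - w - 2)\<close> on
      passing from \<open>v\<close> to \<open>w\<close>; it is nonnegative because both weights are
      at most half of \<open>n\<close>.\<close>
    then have "0 \<le> (w - v) * (n - v - w)" by simp
    then have "3 * (v - 2) * (n - v - 2) \<le> 3 * (w - 2) * (n - w - 2)" by (simp add: algebra_simps)
    then show ?thesis using True by (simp add: harmonic_case_def)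
  next
    case False
    then show ?thesis using Cons by (auto split: if_splits)
  qed
qed simp

text \<open>The weights start at \<open>z\<close>, as a distance never exceeds the weight.\<close>

definition check_length_1 :: "int \<Rightarrow> int \<Rightarrow> int \<Rightarrow> (int \<times> int \<times> int) list \<Rightarrow> int \<Rightarrow> bool" where
  "check_length_1 x z s R n = scan_weights x s R n (three_distance_bound n) [max 4 z..n div 2]"

fun check_1 :: "int \<times> int \<times> int \<times> certificate list \<Rightarrow> bool" where
  "check_1 (x, y, z, C) \<longleftrightarrow> list_all (valid_certificate x y z) C
     \<and> list_all (check_length_1 x z (x + y + z) (map box C)) [11..45]"

text \<open>Encodes the parameter ranges of part (2), for lengths between 11 and 50.\<close>

definition max_weight :: "int \<Rightarrow> int" where
  "max_weight n = (if n \<le> 12 then 4 else if n \<le> 15 then 5 else if n \<le> 19 then 6 else if n \<le> 24 then 7 else 8)"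

definition check_weight_2 :: "(int \<times> int \<times> int) list \<Rightarrow> int \<Rightarrow> int \<Rightarrow> bool" where
  "check_weight_2 R n w = covered R w (n - w) ((n - w + 3) * (n - w + 2) * (n - w + 1) div 6)"

definition check_length_2 :: "int \<Rightarrow> (int \<times> int \<times> int) list \<Rightarrow> int \<Rightarrow> bool" where
  "check_length_2 z R n = list_all (check_weight_2 R n) [max 4 z..max_weight n]"

fun check_2 :: "int \<times> int \<times> int \<times> certificate list \<Rightarrow> bool" where
  "check_2 (x, y, z, C) \<longleftrightarrow> list_all (valid_certificate x y z) C
     \<and> list_all (check_length_2 z (map box C)) [11..50]"

fun key :: "int \<times> int \<times> int \<times> certificate list \<Rightarrow> int \<times> int \<times> int" where
  "key (x, y, z, C) = (x, y, z)"

text \<open>Both tables list all integral triples, with dual solutions found by solving the linear programs numerically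
  and rounding. A triple without certificates is settled by the harmonic bound or the first moment for all lengths.\<close>

definition table_1 :: "(int \<times> int \<times> int \<times> certificate list) list" where
  "table_1 = [
    (1, 2, 3, []),
    (1, 3, 4, [(4, 11, 6000, [(1, 806), (2, 30), (4, 3)], 108)]),
    (2, 3, 4, [(4, 14, 750, [(1, 170), (2, 21), (3, 2)], 214),
      (4, 15, 300, [(1, 88), (2, 11), (3, 1)], 329),
      (4, 25, 4400, [(1, 931), (2, 111), (3, 10)], 956),
      (4, 41, 9900, [(1, 1970), (2, 229), (3, 20)], 3589),
      (5, 8, 3600, [(2, 149), (3, 2), (4, 1)], 114)]),
    (2, 3, 5, [(6, 12, 50000, [(3, 7), (4, 1)], 108)]),
    (2, 4, 6, [(6, 13, 300000, [(1, 38990), (2, 964), (5, 1)], 396),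
      (7, 12, 22000000, [(1, 198927), (3, 876), (6, 1)], 165)]),
    (2, 6, 8, [(8, 17, 9000000000, [(1, 485873676), (7, 1)], 447),
      (10, 13, 360000000, [(1, 1862199), (2, 167004), (6, 1)], 527)]),
    (3, 4, 5, [(5, 39, 62200, [(1, 7855), (2, 515), (3, 20)], 1328),
      (5, 40, 700, [(1, 405), (2, 27), (3, 1)], 6401),
      (6, 16, 120000, [(2, 720), (3, 13), (4, 1)], 218),
      (7, 9, 30000, [(2, 487), (4, 1)], 134)]),
    (3, 4, 6, [(7, 21, 490000, [(3, 9), (4, 1)], 278),
      (8, 9, 5000, [(1, 390), (2, 9), (3, 3)], 115)]),
    (3, 4, 7, [(9, 15, 500000, [(4, 1)], 199)]),
    (3, 5, 6, [(6, 7, 20, [(1, 29), (2, 1)], 124),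
      (6, 39, 790000, [(1, 39109), (2, 525), (4, 1)], 941),
      (8, 13, 3900000, [(1, 23382), (2, 3981), (5, 1)], 276),
      (9, 15, 360000000, [(2, 344202), (5, 4), (6, 1)], 681)]),
    (3, 5, 8, [(9, 17, 856000000, [(3, 19773), (6, 1)], 678),
      (10, 11, 130000000, [(5, 2), (6, 1)], 413)]),
    (3, 6, 9, [(10, 19, 4600000000, [(2, 1743083), (3, 9424), (6, 1)], 663),
      (11, 13, 600000000, [(2, 800280), (6, 1)], 708)]),
    (3, 9, 12, [(12, 25, 500000000000000, [(1, 15070770378448), (8, 1)], 1750),
      (13, 21, 200000000000000, [(1, 9357741445722), (8, 1)], 2142),
      (14, 20, 306000000000000, [(1, 11269467774313), (8, 1)], 2021),
      (15, 17, 100000000000000, [(1, 6385390704000), (8, 1)], 2560)]),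
    (4, 5, 6, [(6, 39, 5000, [(1, 1203), (2, 50), (3, 1)], 1817),
      (7, 38, 1890000, [(2, 2601), (3, 48), (4, 1)], 1139),
      (9, 14, 4000, [(2, 50), (3, 1)], 439)]),
    (4, 5, 9, [(11, 19, 1700000, [(4, 1)], 434)]),
    (4, 6, 7, [(8, 20, 490000, [(2, 1305), (4, 1)], 456),
      (8, 38, 590000000, [(2, 371192), (4, 90), (5, 3)], 2562),
      (10, 15, 18700000, [(2, 17810), (3, 562), (5, 1)], 660),
      (11, 11, 100000, [(2, 1626), (4, 1)], 825)]),
    (4, 6, 8, [(8, 31, 154000000, [(2, 4528), (3, 1151), (5, 1)], 959),
      (9, 19, 114000000, [(2, 104813), (3, 43265), (5, 1)], 1320),
      (10, 11, 2900, [(1, 486), (2, 35), (3, 1)], 384),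
      (10, 14, 2600000000000, [(1, 9144576000), (2, 667951638), (9, 1)], 1019),
      (10, 15, 390000000, [(3, 72035), (4, 410), (6, 1)], 1934),
      (11, 13, 33900000000000, [(2, 12899816014), (3, 1855240495), (10, 1)], 1322)]),
    (4, 6, 10, [(11, 16, 41000000, [(3, 3202), (5, 1)], 969),
      (11, 21, 5400000000, [(3, 98479), (6, 1)], 2551),
      (13, 15, 2800000000, [(3, 70909), (6, 1)], 1709)]),
    (4, 8, 12, [(12, 25, 60000000000, [(2, 9442951), (5, 76), (6, 1)], 2194),
      (14, 21, 50000000000, [(2, 8751391), (6, 1)], 1703),
      (15, 23, 70000000000000, [(3, 99960014), (7, 6)], 3477)]),
    (4, 9, 10, [(10, 11, 10000, [(3, 1)], 72),
      (11, 35, 40000000000000, [(1, 958642468341), (7, 3)], 4237),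
      (12, 22, 43700000000, [(1, 1182206004), (5, 71), (6, 1)], 1313),
      (15, 18, 15000000000000, [(1, 673437058560), (6, 539), (7, 1)], 2090)]),
    (4, 12, 16, [(16, 29, 2000000000000000000, [(1, 62702147424559112), (9, 1)], 7559),
      (18, 28, 770000000000000000000, [(1, 22867010485186052096), (10, 1)], 9836),
      (19, 24, 3280000000000000000, [(1, 52500372630681328), (9, 1)], 4857),
      (20, 22, 2600000000000000000, [(1, 42903890272567296), (9, 1)], 4239),
      (21, 21, 1600000000000000000, [(1, 47211704987166728), (9, 1)], 7124)]),
    (5, 6, 7, [(8, 38, 4000000, [(2, 6973), (3, 70), (4, 1)], 1179),
      (11, 19, 8000, [(2, 25), (3, 1)], 838)]),
    (5, 6, 8, [(8, 37, 50000, [(2, 17), (3, 1)], 339),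
      (10, 30, 3650000, [(2, 2553), (4, 1)], 963),
      (12, 15, 700000, [(2, 3371), (3, 5), (4, 1)], 716)]),
    (5, 6, 11, [(14, 23, 150000000000, [(4, 8151), (6, 1)], 1326)]),
    (5, 7, 12, [(12, 13, 10000, [(1, 448), (2, 103), (3, 1)], 446),
      (13, 25, 44000000000, [(3, 163886), (4, 7735), (6, 1)], 4585),
      (15, 20, 73000000000, [(4, 15576), (5, 8), (6, 1)], 2264)]),
    (5, 8, 9, [(9, 36, 6000000, [(1, 173509), (3, 42), (4, 1)], 874),
      (11, 32, 1026000000, [(1, 2660971), (2, 217830), (5, 1)], 1330),
      (12, 19, 700000, [(2, 2535), (4, 1)], 1743),
      (14, 18, 300000000, [(2, 133966), (5, 1)], 849)]),
    (5, 10, 15, [(15, 30, 35000000000000, [(2, 11563940606), (6, 39), (7, 1)], 11285),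
      (16, 27, 64400000000000, [(5, 13371), (6, 212), (7, 1)], 9107),
      (17, 24, 130000000000000, [(5, 34213), (6, 812), (7, 1)], 7706),
      (18, 23, 290000000000, [(2, 1235148), (6, 1)], 3351),
      (19, 21, 200000000000, [(1, 847017689), (2, 7265109), (6, 1)], 3824)]),
    (5, 15, 20, [(20, 25, 40000000000000000, [(1, 508001284803990), (7, 173), (8, 1)], 9638),
      (22, 24, 10000000000000000000, [(1, 191905964135087392), (9, 1)], 8575)]),
    (6, 7, 8, [(9, 37, 200, [(2, 1)], 480),
      (13, 33, 10400000, [(3, 18), (4, 1)], 1718)]),
    (6, 7, 9, [(9, 36, 50000, [(1, 2686), (2, 81), (3, 1)], 597),
      (11, 35, 5900000, [(2, 5463), (3, 17), (4, 1)], 1921),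
      (14, 19, 10000000, [(2, 15556), (3, 1), (4, 4)], 993)]),
    (6, 7, 13, [(16, 27, 800000000000, [(4, 13062), (5, 13), (6, 1)], 1919),
      (17, 17, 10000, [(3, 1)], 1665)]),
    (6, 8, 9, [(10, 36, 4000000, [(2, 8959), (3, 41), (4, 1)], 2352),
      (11, 32, 4425000, [(2, 6716), (3, 47), (4, 1)], 2024),
      (14, 20, 2000000, [(2, 5141), (3, 14), (4, 1)], 1680),
      (15, 21, 300000000, [(2, 167230), (3, 6946), (5, 1)], 3487)]),
    (6, 8, 10, [(11, 35, 8000000, [(1, 784166), (3, 848), (4, 1)], 5403),
      (12, 25, 14000, [(1, 6777), (2, 14), (3, 5)], 6731),
      (13, 24, 3160000, [(2, 4735), (3, 37), (4, 1)], 1758),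
      (15, 18, 1600000, [(2, 5496), (3, 17), (4, 1)], 1867)]),
    (6, 8, 12, [(12, 33, 29000000, [(3, 341), (4, 3)], 1716),
      (16, 27, 2870000000, [(4, 81), (5, 1)], 2289),
      (17, 17, 10000, [(3, 1)], 1665)]),
    (6, 8, 14, [(14, 29, 800000000, [(3, 9251), (4, 175), (5, 1)], 7829),
      (16, 25, 1580000000, [(3, 4183), (4, 72), (5, 1)], 2843),
      (18, 20, 1000000000, [(3, 7922), (4, 126), (5, 1)], 3255)]),
    (6, 9, 12, [(12, 13, 50, [(1, 135), (2, 1)], 834),
      (13, 33, 500000000, [(1, 7198309), (3, 8641), (5, 1)], 9774),
      (14, 28, 203000000000, [(2, 9316431), (3, 41401), (6, 1)], 2905),
      (16, 22, 60000000000, [(1, 1197843865), (3, 33753), (6, 1)], 5187),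
      (17, 19, 156238000000, [(4, 382), (5, 9), (6, 2)], 2301)]),
    (6, 9, 15, [(15, 15, 3000000, [(1, 396990), (3, 176), (4, 1)], 825),
      (16, 30, 80000000000000, [(3, 82271846), (6, 23), (7, 1)], 8188),
      (17, 24, 230000000000, [(3, 643501), (6, 1)], 3894),
      (19, 22, 170000000000, [(3, 728108), (6, 1)], 6404)]),
    (6, 10, 12, [(13, 33, 2000000000, [(1, 95447888), (4, 238), (5, 1)], 4226),
      (16, 29, 310000000000, [(1, 12433130261), (2, 10458226), (6, 1)], 6387),
      (18, 21, 1500000000, [(1, 33771841), (2, 54470), (5, 1)], 1687)]),
    (6, 10, 16, [(17, 29, 350000000000, [(3, 714723), (5, 41), (6, 1)], 10130),
      (18, 26, 200000000000, [(3, 759043), (5, 5), (6, 1)], 11571),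
      (19, 25, 510000000000, [(2, 36468632), (3, 366738), (6, 1)], 4957),
      (21, 22, 490000000000, [(2, 45434554), (3, 276955), (6, 1)], 4344)]),
    (6, 12, 18, [(19, 27, 360000000000000, [(5, 54053), (6, 478), (7, 1)], 10716),
      (20, 24, 800000000000, [(5, 157), (6, 1)], 5243),
      (20, 25, 300000000000000, [(5, 68572), (6, 597), (7, 1)], 12948),
      (21, 24, 299000000000000, [(5, 42530), (6, 418), (7, 1)], 10484),
      (22, 23, 500000000000000, [(5, 69669), (6, 723), (7, 2)], 11673)]),
    (6, 20, 21, [(22, 24, 1000000000000000, [(7, 1)], 1500)]),
    (7, 8, 9, [(10, 36, 400, [(1, 38), (2, 1)], 318),
      (11, 33, 600, [(2, 1)], 194),
      (14, 32, 40000000, [(3, 367), (4, 1)], 1115),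
      (15, 17, 900, [(1, 3), (2, 1)], 65)]),
    (7, 8, 15, [(15, 30, 10000000, [(3, 192), (4, 1)], 3432),
      (19, 27, 2000000000000, [(4, 25594), (5, 13), (6, 1)], 2671)]),
    (7, 9, 10, [(11, 35, 5000, [(1, 5058), (2, 79), (3, 1)], 10234),
      (12, 33, 9000000, [(2, 13370), (3, 36), (4, 1)], 1677),
      (14, 32, 1810000000, [(2, 316727), (3, 11503), (5, 1)], 3653),
      (17, 20, 4000000, [(2, 8779), (3, 12), (4, 1)], 1972)]),
    (7, 9, 16, [(17, 29, 7000000000, [(3, 9937), (4, 176), (5, 1)], 2458),
      (20, 26, 4000000000, [(3, 3484), (4, 38), (5, 1)], 4161),
      (21, 21, 5000000000, [(3, 16463), (4, 212), (5, 1)], 2278)]),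
    (7, 10, 12, [(12, 33, 10000000, [(1, 431865), (3, 84), (4, 1)], 1547),
      (14, 32, 2080000000, [(1, 54911838), (4, 42), (5, 1)], 3222),
      (15, 27, 1400000, [(2, 7599), (4, 1)], 10657),
      (17, 26, 1650000000, [(1, 1579414), (2, 708112), (5, 1)], 3629),
      (19, 20, 898000000, [(1, 25726373), (2, 27886), (5, 1)], 2906)]),
    (7, 14, 21, [(22, 24, 2000000000, [(1, 80166240), (5, 1)], 8081)]),
    (8, 9, 10, [(12, 34, 1000, [(1, 28), (2, 1)], 160),
      (13, 31, 1000, [(2, 1)], 146),
      (16, 30, 200000, [(2, 14), (3, 1)], 424),
      (17, 19, 1000, [(1, 3), (2, 1)], 94)]),
    (8, 9, 11, [(11, 34, 900, [(1, 145), (2, 1)], 198),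
      (13, 33, 50000, [(1, 6203), (2, 28), (3, 1)], 1269),
      (17, 29, 6900000000, [(2, 5730918), (4, 479), (5, 1)], 3978),
      (18, 19, 200, [(1, 46), (2, 3)], 1649)]),
    (8, 9, 12, [(12, 33, 100000, [(1, 6494), (2, 143), (3, 1)], 658),
      (14, 32, 100000, [(1, 3974), (2, 15), (3, 1)], 695),
      (17, 29, 9000000, [(1, 73051), (2, 9837), (4, 1)], 3864),
      (19, 20, 10000, [(1, 4928), (3, 1)], 4165)]),
    (8, 9, 17, [(18, 28, 80000000, [(3, 240), (4, 1)], 740),
      (19, 26, 80000000, [(3, 226), (4, 1)], 674),
      (21, 25, 80000000000, [(3, 39370), (4, 470), (5, 3)], 895),
      (22, 23, 10000000, [(3, 193), (4, 1)], 5626)]),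
    (8, 10, 12, [(12, 33, 500000, [(1, 26593), (2, 439), (3, 3)], 403),
      (14, 32, 30000, [(1, 4658), (2, 57), (3, 1)], 2580),
      (15, 30, 5900, [(1, 4454), (2, 15), (3, 1)], 12076),
      (18, 28, 9000000, [(2, 9196), (3, 11), (4, 1)], 4364),
      (19, 21, 6000000, [(1, 10048), (2, 15010), (4, 1)], 2588)]),
    (8, 10, 18, [(19, 27, 10000000, [(3, 277), (4, 1)], 6745),
      (21, 25, 10000000000, [(3, 46300), (4, 393), (5, 1)], 3781),
      (22, 23, 7000000, [(3, 215), (4, 1)], 8346)]),
    (8, 11, 12, [(12, 33, 200000, [(1, 402), (3, 1)], 217),
      (14, 32, 20000000, [(1, 69588), (4, 1)], 1039),
      (16, 30, 9000000, [(2, 12420), (4, 1)], 3481),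
      (18, 28, 3000000000, [(2, 741390), (5, 1)], 4100),
      (20, 22, 5000000, [(2, 12116), (4, 1)], 4509)]),
    (8, 12, 14, [(14, 31, 200000, [(1, 2907), (3, 1)], 301),
      (16, 30, 40000000, [(1, 506941), (3, 37), (4, 1)], 801),
      (18, 28, 10000000, [(1, 758857), (4, 1)], 3648),
      (20, 26, 5000000000, [(1, 143364975), (4, 49), (5, 1)], 3361),
      (22, 24, 3000000000, [(1, 144412084), (4, 4), (5, 1)], 5458)]),
    (8, 12, 16, [(17, 29, 7000000000, [(1, 68511950), (4, 121), (5, 1)], 2080),
      (18, 27, 7000000000, [(1, 68755183), (4, 99), (5, 1)], 1866),
      (20, 26, 6000000000, [(1, 72302097), (2, 253437), (5, 1)], 2465),
      (22, 24, 3000000000, [(1, 138896931), (3, 645), (5, 1)], 5422)]),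
    (8, 12, 20, [(20, 25, 7000000000, [(1, 59709645), (5, 1)], 1699),
      (22, 24, 8000000000, [(2, 938102), (5, 1)], 2045)]),
    (8, 14, 15, [(15, 30, 400000, [(3, 1)], 167),
      (17, 29, 100000, [(3, 1)], 895),
      (18, 27, 40000, [(3, 1)], 2149),
      (20, 26, 80000000, [(3, 47), (4, 1)], 585),
      (22, 24, 100000000, [(1, 33073), (4, 1)], 448)]),
    (8, 18, 20, [(20, 25, 10000000, [(3, 319), (4, 1)], 6542),
      (22, 24, 20000000000, [(4, 142), (5, 1)], 1124)]),
    (9, 10, 11, [(13, 32, 2000, [(1, 93), (2, 1)], 97),
      (15, 31, 2000, [(2, 1)], 98),
      (19, 27, 300000, [(2, 78), (3, 1)], 403)]),
    (9, 10, 12, [(13, 32, 2000, [(1, 147), (2, 1)], 108),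
      (15, 31, 100, [(1, 43), (2, 1)], 2153),
      (16, 29, 60, [(1, 25), (2, 1)], 3442),
      (19, 27, 30000, [(2, 165), (3, 1)], 4722),
      (20, 21, 400, [(1, 25), (2, 1)], 426)]),
    (9, 10, 15, [(15, 30, 10000, [(1, 3788), (2, 188), (3, 1)], 10256),
      (17, 29, 500000, [(2, 73), (3, 1)], 212),
      (18, 27, 500000, [(2, 56), (3, 1)], 196),
      (20, 26, 500000, [(3, 1)], 214),
      (22, 24, 400000, [(3, 1)], 281)]),
    (9, 10, 19, [(19, 26, 500000, [(2, 26), (3, 1)], 193),
      (21, 25, 500000, [(3, 1)], 221),
      (22, 23, 500000, [(3, 1)], 197)]),
    (9, 11, 12, [(13, 32, 2000, [(1, 147), (2, 1)], 108),
      (15, 31, 100, [(1, 43), (2, 1)], 2153),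
      (17, 29, 200000, [(2, 743), (3, 1)], 1268),
      (19, 27, 30000, [(2, 165), (3, 1)], 4722),
      (21, 22, 200000, [(2, 563), (3, 1)], 915)]),
    (9, 11, 20, [(20, 25, 300000, [(2, 84), (3, 1)], 379),
      (22, 24, 300000, [(2, 20), (3, 1)], 392)]),
    (9, 12, 13, [(14, 32, 40000, [(1, 22858), (2, 276), (3, 1)], 3127),
      (16, 30, 60000, [(1, 9655), (2, 124), (3, 1)], 1873),
      (18, 28, 20000000, [(1, 815), (2, 18996), (4, 1)], 2025),
      (20, 26, 60000000, [(2, 41343), (4, 3)], 2257),
      (22, 24, 40000000, [(2, 41409), (4, 3)], 3622)]),
    (9, 12, 15, [(15, 30, 50000, [(1, 17500), (2, 257), (3, 1)], 2427),
      (17, 29, 20000, [(1, 6390), (2, 164), (3, 1)], 6442),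
      (18, 27, 40000, [(1, 5385), (2, 146), (3, 1)], 2998),
      (20, 26, 6800000, [(1, 646071), (2, 6483), (4, 1)], 6421),
      (22, 24, 2000000000, [(1, 86612405), (3, 17111), (5, 1)], 9042)]),
    (9, 12, 18, [(19, 27, 30000, [(2, 165), (3, 1)], 4722),
      (21, 25, 29000, [(2, 87), (3, 1)], 4554),
      (22, 23, 30000, [(2, 313), (3, 3)], 12258)]),
    (9, 12, 21, [(22, 24, 20000, [(2, 75), (3, 1)], 6567)]),
    (9, 14, 15, [(15, 30, 500000, [(2, 97), (3, 1)], 169),
      (17, 29, 600000, [(3, 1)], 150),
      (18, 27, 600000, [(3, 1)], 144),
      (20, 26, 100000, [(1, 4477), (3, 1)], 1091),
      (22, 24, 18000, [(1, 4197), (3, 1)], 6358)]),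
    (9, 15, 18, [(19, 27, 600000, [(3, 1)], 171),
      (21, 25, 500000, [(3, 1)], 221),
      (22, 23, 500000, [(3, 1)], 197)]),
    (10, 11, 12, [(15, 30, 4000, [(1, 98), (2, 1)], 57),
      (17, 29, 2000, [(1, 36), (2, 1)], 120),
      (18, 27, 3000, [(1, 24), (2, 1)], 76),
      (20, 26, 2000, [(2, 1)], 124),
      (21, 23, 3000, [(1, 3), (2, 1)], 72)]),
    (10, 11, 21, [(22, 24, 900000, [(2, 148), (3, 1)], 167)]),
    (10, 12, 13, [(16, 30, 2000, [(1, 99), (2, 1)], 129),
      (18, 28, 700, [(1, 64), (2, 1)], 377),
      (19, 26, 800, [(1, 58), (2, 1)], 314),
      (21, 25, 1000, [(1, 9), (2, 1)], 257),
      (22, 23, 900, [(1, 28), (2, 1)], 276)]),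
    (10, 12, 14, [(16, 30, 800, [(1, 181), (2, 1)], 370),
      (18, 28, 400000, [(1, 16316), (2, 171), (3, 1)], 361),
      (19, 26, 300000, [(1, 15585), (2, 160), (3, 1)], 447),
      (21, 25, 80000, [(1, 12577), (2, 93), (3, 1)], 1753),
      (22, 23, 200000, [(1, 11239), (2, 98), (3, 1)], 634)]),
    (10, 12, 15, [(16, 30, 500, [(1, 200), (2, 1)], 610),
      (18, 28, 300000, [(1, 14065), (2, 189), (3, 1)], 491),
      (19, 26, 300000, [(1, 13314), (2, 179), (3, 1)], 457),
      (21, 25, 300000, [(1, 9087), (2, 123), (3, 1)], 487),
      (22, 23, 300000, [(1, 9696), (2, 132), (3, 1)], 447)]),
    (10, 12, 16, [(16, 29, 200, [(1, 299), (2, 1)], 1669),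
      (18, 28, 40000, [(1, 14324), (2, 233), (3, 1)], 3934),
      (19, 26, 50000, [(1, 13440), (2, 222), (3, 1)], 2934),
      (21, 25, 100000, [(1, 7533), (2, 167), (3, 1)], 1562),
      (22, 23, 100000, [(1, 9471), (2, 184), (3, 1)], 1460)]),
    (10, 12, 22, [(22, 23, 500000, [(1, 3826), (2, 406), (3, 1)], 391)]),
    (10, 13, 15, [(16, 30, 500, [(1, 200), (2, 1)], 610),
      (18, 28, 900000, [(1, 47331), (2, 552), (3, 3)], 490),
      (19, 26, 900000, [(1, 44601), (2, 524), (3, 3)], 457),
      (21, 25, 200000, [(1, 31279), (2, 395), (3, 3)], 2232),
      (22, 23, 400000, [(1, 35221), (2, 434), (3, 3)], 1035)]),
    (10, 15, 16, [(16, 29, 200, [(1, 299), (2, 1)], 1669),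
      (18, 28, 500000, [(2, 85), (3, 1)], 232),
      (19, 26, 200000, [(2, 89), (3, 1)], 553),
      (21, 25, 600000, [(2, 31), (3, 1)], 197),
      (22, 23, 400000, [(2, 50), (3, 1)], 275)]),
    (10, 15, 20, [(20, 25, 300000, [(2, 71), (3, 1)], 369),
      (22, 24, 700000, [(3, 1)], 161)]),
    (10, 16, 18, [(19, 27, 400000, [(2, 136), (3, 1)], 337),
      (21, 25, 500000, [(2, 112), (3, 1)], 277),
      (22, 23, 400000, [(2, 120), (3, 1)], 316)]),
    (11, 12, 13, [(20, 25, 4000, [(1, 98), (2, 1)], 70),
      (22, 24, 4000, [(1, 59), (2, 1)], 72)]),
    (11, 12, 14, [(20, 25, 4000, [(1, 153), (2, 1)], 77),
      (22, 24, 3000, [(1, 97), (2, 1)], 103)]),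
    (11, 12, 15, [(20, 25, 4000, [(1, 207), (2, 1)], 83),
      (22, 24, 1000, [(1, 170), (2, 1)], 345)]),
    (11, 15, 16, [(20, 25, 3000, [(1, 262), (2, 1)], 120),
      (22, 24, 300, [(1, 226), (2, 1)], 1248)]),
    (12, 13, 14, []),
    (12, 13, 15, []),
    (12, 13, 16, []),
    (12, 14, 15, []),
    (12, 14, 16, []),
    (12, 14, 18, []),
    (12, 15, 16, []),
    (12, 15, 17, []),
    (12, 15, 18, []),
    (12, 16, 18, []),
    (12, 16, 20, []),
    (12, 18, 21, []),
    (13, 14, 15, []),
    (13, 15, 16, []),
    (13, 15, 18, []),
    (14, 15, 16, []),
    (14, 15, 17, []),
    (14, 15, 20, []),
    (14, 15, 21, []),
    (14, 16, 18, []),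
    (14, 18, 20, []),
    (14, 20, 21, []),
    (15, 16, 17, []),
    (15, 16, 18, []),
    (15, 16, 19, []),
    (15, 16, 20, []),
    (15, 16, 21, []),
    (15, 17, 18, []),
    (15, 17, 20, []),
    (15, 18, 20, []),
    (15, 18, 21, []),
    (15, 19, 20, []),
    (15, 20, 21, []),
    (15, 21, 22, []),
    (16, 17, 18, []),
    (16, 18, 19, []),
    (16, 18, 20, []),
    (16, 18, 22, []),
    (16, 20, 21, []),
    (17, 18, 19, []),
    (17, 18, 20, []),
    (17, 20, 21, []),
    (18, 19, 20, []),
    (18, 19, 21, []),
    (18, 20, 21, []),
    (18, 20, 22, []),
    (19, 20, 21, []),
    (19, 21, 22, []),
    (20, 21, 22, [])]"

definition table_2 :: "(int \<times> int \<times> int \<times> certificate list) list" where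
  "table_2 = [
    (1, 2, 3, [(4, 7, 31800, [(2, 1525), (3, 203), (4, 100)], 120),
      (4, 46, 557590000, [(2, 2250748), (3, 373841), (4, 100001)], 18424),
      (5, 8, 5340000, [(3, 15167), (4, 501), (5, 584)], 165),
      (5, 9, 1477000, [(3, 2885), (4, 153), (5, 100)], 220),
      (5, 45, 114086000000, [(3, 3828079), (4, 452676), (5, 100001)], 17296),
      (6, 10, 6500000, [(4, 423), (6, 10)], 286),
      (6, 11, 67990000, [(4, 2847), (5, 50), (6, 61)], 364),
      (6, 12, 349000000, [(4, 9913), (5, 299), (6, 200)], 455),
      (6, 44, 2601440000000, [(4, 586595), (5, 52218), (6, 10000)], 16215),
      (7, 13, 628000000, [(5, 343), (7, 5)], 560),
      (7, 14, 518000000000, [(5, 183148), (6, 2002), (7, 2517)], 680),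
      (7, 15, 158650000000, [(5, 37838), (6, 734), (7, 500)], 816),
      (7, 16, 93390000000, [(5, 15545), (6, 407), (7, 200)], 969),
      (7, 43, 12796900000000000, [(5, 16795253), (6, 1159229), (7, 200002)], 15180),
      (8, 17, 346300000000000, [(6, 670609), (7, 5001), (8, 6433)], 1140),
      (8, 18, 82270000000000, [(6, 107152), (7, 1451), (8, 1000)], 1330),
      (8, 19, 60620000000000, [(6, 54626), (7, 1016), (8, 500)], 1540),
      (8, 20, 86680000000000, [(6, 55392), (7, 1266), (8, 500)], 1771),
      (8, 21, 483300000000000, [(6, 223808), (7, 5931), (8, 2000)], 2024),
      (8, 22, 1647800000000000, [(6, 563638), (7, 16709), (8, 5000)], 2300),
      (8, 23, 881700000000000, [(6, 226674), (7, 7341), (8, 2000)], 2600),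
      (8, 24, 29000000000000, [(6, 5689), (7, 198), (8, 50)], 2925),
      (8, 25, 3760000000000000, [(6, 570578), (7, 21074), (8, 5000)], 3276),
      (8, 26, 1924400000000000, [(6, 228717), (7, 8883), (8, 2000)], 3654),
      (8, 27, 608300000000000, [(6, 57266), (7, 2322), (8, 500)], 4060),
      (8, 28, 7610000000000000, [(6, 573281), (7, 24129), (8, 5000)], 4495),
      (8, 29, 18858000000000000, [(6, 1147523), (7, 49902), (8, 10001)], 4960),
      (8, 30, 46309000000000000, [(6, 2296145), (7, 102773), (8, 20002)], 5456),
      (8, 31, 28194000000000000, [(6, 1148277), (7, 52731), (8, 10000)], 5984),
      (8, 32, 34077000000000000, [(6, 1148418), (7, 53963), (8, 10000)], 6545),
      (8, 33, 40904000000000000, [(6, 1148535), (7, 55097), (8, 10001)], 7140),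
      (8, 34, 48775000000000000, [(6, 1148318), (7, 56129), (8, 10000)], 7770),
      (8, 35, 11562000000000000, [(6, 229627), (7, 11417), (8, 2000)], 8436),
      (8, 36, 136300000000000000, [(6, 2296001), (7, 115951), (8, 20002)], 9139),
      (8, 37, 159820000000000000, [(6, 2295412), (7, 117591), (8, 20002)], 9880),
      (8, 38, 466100000000000000, [(6, 5736313), (7, 297759), (8, 50000)], 10660),
      (8, 39, 54135000000000000, [(6, 573453), (7, 30131), (8, 5000)], 11480),
      (8, 40, 1251900000000000000, [(6, 11465418), (7, 609260), (8, 100001)], 12341),
      (8, 41, 72083000000000000, [(6, 573072), (7, 30773), (8, 5000)], 13244),
      (8, 42, 826900000000000000, [(6, 5728738), (7, 310642), (8, 50000)], 14190)]),
    (1, 3, 4, [(4, 46, 50000, [(1, 6929), (2, 373), (4, 3)], 5851),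
      (5, 9, 59000, [(1, 8914), (2, 300), (5, 3)], 107),
      (5, 45, 6807000, [(2, 10385), (3, 295), (5, 2)], 5451),
      (6, 13, 4000000, [(2, 18835), (3, 237), (6, 1)], 257),
      (6, 44, 400000000, [(3, 8802), (4, 132), (6, 1)], 9746),
      (7, 16, 600000000, [(3, 56637), (7, 1)], 551),
      (7, 43, 100000000000, [(4, 13999), (5, 85), (7, 1)], 8782),
      (8, 17, 40000000000, [(3, 1318550), (4, 40986), (8, 1)], 1132),
      (8, 21, 300000000000, [(4, 168053), (8, 1)], 1238),
      (8, 24, 600000000000, [(4, 204021), (5, 1568), (8, 1)], 2229),
      (8, 29, 2370000000000, [(4, 241126), (5, 5159), (8, 1)], 3251),
      (8, 30, 2000000000000, [(4, 243818), (5, 6034), (8, 1)], 5239),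
      (8, 42, 34600000000000, [(4, 48525), (5, 20505), (8, 1)], 5959)]),
    (2, 3, 4, [(4, 46, 800, [(1, 201), (2, 23), (3, 2)], 6226),
      (5, 9, 6000, [(2, 157), (3, 4), (4, 1)], 119),
      (5, 45, 209000, [(2, 1386), (3, 96), (4, 7)], 16982),
      (6, 13, 8000000, [(3, 3618), (4, 10), (5, 13)], 282),
      (6, 44, 10000000, [(3, 382), (4, 17), (5, 1)], 11742),
      (7, 14, 31000000, [(3, 2029), (4, 266), (6, 1)], 555),
      (7, 19, 898000000, [(4, 2634), (5, 9), (6, 5)], 813),
      (7, 43, 2000000000, [(4, 614), (5, 19), (6, 1)], 14591),
      (8, 17, 5600000000, [(4, 4887), (5, 340), (7, 1)], 1093),
      (8, 19, 11900000000, [(4, 4200), (5, 479), (7, 1)], 1294),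
      (8, 24, 56400000000, [(5, 803), (6, 1), (7, 1)], 1770),
      (8, 31, 4730000000000, [(5, 18088), (6, 217), (7, 20)], 3274),
      (8, 40, 400500000000000, [(5, 456853), (6, 8674), (7, 500)], 6542),
      (8, 42, 700000000000, [(5, 920), (6, 18), (7, 1)], 10692)]),
    (2, 3, 5, [(5, 9, 800, [(2, 7), (3, 1)], 51),
      (5, 45, 200000, [(1, 7400), (3, 18), (4, 1)], 2614),
      (6, 44, 30000000, [(2, 37430), (4, 62), (5, 3)], 11878),
      (7, 16, 5000000, [(4, 2), (5, 1)], 279),
      (7, 43, 3000000000, [(3, 24643), (5, 30), (6, 1)], 10413),
      (8, 27, 3800000000, [(3, 5540), (6, 1)], 1140),
      (8, 37, 1730000000000, [(3, 4793716), (6, 103), (7, 2)], 4472),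
      (8, 42, 1800000000000, [(3, 5924710), (6, 91), (7, 2)], 10018)]),
    (2, 4, 6, [(6, 10, 300000, [(1, 1504), (2, 294), (5, 1)], 76),
      (6, 44, 87870000, [(1, 1827956), (3, 1463), (5, 2)], 2300),
      (7, 15, 69000000, [(3, 2482), (4, 179), (6, 1)], 356),
      (7, 43, 2000000000, [(2, 1817361), (4, 789), (6, 1)], 12112),
      (8, 17, 5000000000, [(2, 7182121), (4, 840), (7, 1)], 829),
      (8, 21, 25500000000, [(4, 3383), (5, 572), (7, 1)], 1327),
      (8, 22, 22000000000, [(4, 2396), (5, 669), (7, 1)], 2254),
      (8, 28, 116000000000, [(2, 21760587), (5, 740), (7, 1)], 2588),
      (8, 34, 260000000000, [(2, 64982440), (5, 847), (7, 1)], 4952),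
      (8, 36, 300000000000, [(2, 84829694), (5, 892), (7, 1)], 6579),
      (8, 42, 630000000000, [(2, 164686853), (5, 1038), (7, 1)], 9858)]),
    (2, 6, 8, [(8, 22, 31700000000, [(1, 1580510131), (2, 22498393), (7, 1)], 1121),
      (8, 27, 78000000000, [(1, 5178440030), (2, 80343206), (7, 1)], 2369),
      (8, 31, 123000000000, [(1, 10719300745), (2, 177920117), (7, 1)], 4442),
      (8, 33, 140000000000, [(1, 14649167738), (2, 251643102), (7, 1)], 6335),
      (8, 42, 750000000000, [(2, 26417725), (3, 7474738), (7, 1)], 7544)]),
    (3, 4, 5, [(5, 8, 70, [(1, 25), (2, 1)], 31),
      (5, 45, 2000, [(1, 819), (2, 53), (3, 2)], 6250),
      (6, 16, 120000, [(2, 720), (3, 13), (4, 1)], 218),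
      (6, 44, 200000, [(2, 932), (3, 33), (4, 1)], 7703),
      (7, 16, 3400000, [(2, 3552), (3, 727), (5, 1)], 550),
      (7, 43, 60000000, [(3, 1728), (4, 34), (5, 1)], 6710),
      (8, 19, 2600000000, [(3, 238580), (5, 207), (6, 1)], 1078),
      (8, 27, 3200000000, [(3, 2899), (4, 1851), (6, 1)], 1758),
      (8, 42, 118300000000, [(4, 13221), (5, 132), (6, 5)], 4489)]),
    (3, 4, 6, [(6, 44, 600000, [(1, 31503), (3, 57), (4, 1)], 2875),
      (7, 18, 273600, [(3, 16), (4, 1)], 286),
      (7, 43, 100000000, [(2, 81008), (4, 87), (5, 1)], 5137),
      (8, 18, 20000000, [(2, 53487), (4, 93), (5, 1)], 966),
      (8, 40, 348000000, [(2, 40104), (5, 1)], 1535),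
      (8, 42, 100000000, [(2, 40882), (5, 1)], 6900)]),
    (3, 4, 7, [(7, 43, 1350000000, [(1, 34405418), (4, 509), (5, 5)], 2024),
      (8, 24, 140000000, [(4, 92), (5, 1)], 527),
      (8, 35, 20000000000, [(4, 4910), (5, 27), (6, 2)], 3228),
      (8, 42, 12000000000, [(4, 2670), (5, 20), (6, 1)], 8493)]),
    (3, 5, 6, [(6, 12, 50000, [(1, 1468), (3, 13), (4, 1)], 129),
      (6, 44, 600000, [(1, 49015), (2, 716), (4, 1)], 2045),
      (7, 19, 11900000, [(2, 26643), (4, 32), (5, 1)], 538),
      (7, 43, 150000000, [(2, 105881), (3, 25), (5, 1)], 1997),
      (8, 19, 700000000, [(2, 869132), (5, 29), (6, 1)], 975),
      (8, 25, 9100000000, [(2, 8784795), (5, 69), (6, 5)], 1770),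
      (8, 29, 2600000000, [(2, 2858724), (5, 7), (6, 1)], 2960),
      (8, 41, 80500000000, [(3, 658152), (5, 163), (6, 5)], 5454),
      (8, 42, 8000000000, [(3, 140287), (5, 32), (6, 1)], 12668)]),
    (3, 5, 8, [(8, 24, 2300000000, [(3, 27982), (5, 9), (6, 1)], 1034),
      (8, 41, 21000000000, [(1, 165424711), (3, 98650), (6, 1)], 3212),
      (8, 42, 50000000000, [(1, 467919296), (3, 275070), (6, 3)], 4700)]),
    (4, 5, 6, [(6, 10, 4, [(1, 1)], 16),
      (6, 44, 2000, [(1, 1214), (2, 51), (3, 1)], 6376),
      (7, 22, 650000, [(2, 2088), (3, 23), (4, 1)], 358),
      (7, 43, 1000000, [(2, 2886), (3, 57), (4, 1)], 3594),
      (8, 22, 400000, [(2, 1720), (3, 9), (4, 1)], 919),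
      (8, 42, 370000000, [(3, 4542), (4, 36), (5, 1)], 2578)]),
    (4, 6, 7, [(7, 13, 5000, [(1, 1299), (2, 58), (3, 1)], 172),
      (7, 43, 1000000, [(1, 93805), (2, 485), (4, 1)], 2553),
      (8, 22, 496000, [(2, 1491), (4, 1)], 673),
      (8, 42, 326000000, [(2, 168829), (4, 30), (5, 1)], 2570)]),
    (4, 6, 8, [(8, 19, 37000000, [(3, 629), (4, 51), (5, 3)], 1009),
      (8, 42, 419000000, [(1, 2294098), (3, 2165), (5, 1)], 1759)]),
    (5, 6, 7, [(7, 43, 388470, [(1, 24842), (2, 719), (3, 10)], 560),
      (8, 42, 5900000, [(2, 5826), (3, 64), (4, 1)], 1112)]),
    (5, 6, 8, [(8, 42, 90000, [(2, 6), (3, 1)], 264)]),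
    (6, 7, 8, [(8, 42, 90000, [(1, 6329), (2, 135), (3, 1)], 426)])]"

text \<open>Lengths up to 45 have weights at most 22, which also bounds all distances. The table
  follows the order of the enumeration, so completeness is an equality of lists.\<close>

lemma table_1_complete: "map key table_1 = integral_triples 22"
  by code_simp

text \<open>In part (2) weights, hence distances, are at most 8.\<close>

lemma table_2_complete: "map key table_2 = integral_triples 8"
  by code_simp

lemma table_1_correct: "list_all check_1 table_1"
  by code_simp

lemma table_2_correct: "list_all check_2 table_2"
  by code_simp

section \<open>Families with three distances\<close>

definition distances :: "nat set set \<Rightarrow> nat set" where
  "distances F = {card (S - T) | S T. S \<in> F \<and> T \<in> F \<and> S \<noteq> T}"

lemma distances_range:
  assumes F: "uniform_family a b F" and d: "d \<in> distances F"
  shows "0 < d" "d \<le> a"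
proof -
  obtain S T where ST: "S \<in> F" "T \<in> F" "S \<noteq> T" "d = card (S - T)"
    using d by (auto simp: distances_def)
  have fin: "finite S" "finite T" and card: "card S = card T"
    using F ST by (auto simp: uniform_family_def intro: finite_subset)
  show "d \<le> a" using uniform_family_counts(1)[OF F ST(1,2)] ST by simp
  have "\<not> S \<subseteq> T" using card_subset_eq[OF fin(2), of S] card ST by auto
  then show "0 < d" using ST fin by (simp add: card_gt_0_iff)
qed

lemma three_element_nat_set:
  assumes "card (D :: nat set) = 3"
  obtains x y z where "D = {x, y, z}" "x < y" "y < z"
proof -
  have fin: "finite D" using assms by (auto intro: card_ge_0_finite)
  have "\<exists>x y z. l = [x, y, z]" if "length l = 3" for l :: "nat list"
    using that by (auto simp: numeral_3_eq_3 length_Suc_conv)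
  from this[of "sorted_list_of_set D"] obtain x y z where l: "sorted_list_of_set D = [x, y, z]"
    using assms by auto
  have "sorted_wrt (<) [x, y, z]" using strict_sorted_list_of_set[of D] l by simp
  moreover have "D = {x, y, z}" using fin l set_sorted_list_of_set[of D] by simp
  ultimately show ?thesis using that by auto
qed

lemma integral_triple_distances:
  assumes F: "uniform_family a b F" "distances F = {x, y, z}" "x < y" "y < z" "2 \<le> a"
    and large: "(a + b) choose 2 < card F"
  shows "integral_triple (int x) (int y) (int z)"
proof -
  have "int (card (S - T)) \<in> {int x, int y, int z}" if "S \<in> F" "T \<in> F" "S \<noteq> T" for S T
    using F(2) that by (auto simp: distances_def)
  then have "(int y - int x) * (int z - int x) dvd int y * int z"
    "(int x - int y) * (int z - int y) dvd int x * int z"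
    "(int x - int z) * (int y - int z) dvd int x * int y"
    using F large by (auto intro!: distance_dvd[OF F(1)])
  then show ?thesis by (simp add: integral_triple_def dvd_eq_mod_eq_0)
qed

section \<open>Binomial estimates\<close>

lemma two_mult_choose_2: "2 * int (n choose 2) = int n * (int n - 1)"
  by (induction n) (simp_all add: numeral_2_eq_2 algebra_simps)

lemma six_mult_choose_3: "6 * int (n choose 3) = int n * (int n - 1) * (int n - 2)"
proof (induction n)
  case (Suc n)
  have "Suc n choose 3 = (n choose 2) + (n choose 3)"
    by (simp add: numeral_3_eq_3 numeral_2_eq_2)
  then have "6 * int (Suc n choose 3) = 3 * (2 * int (n choose 2)) + 6 * int (n choose 3)" by simp
  also have "\<dots> = int (Suc n) * (int (Suc n) - 1) * (int (Suc n) - 2)"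
    unfolding Suc two_mult_choose_2 by (simp add: algebra_simps)
  finally show ?case .
qed simp

lemma three_distance_bound_eq:
  "three_distance_bound (int n) = int (n choose 3) - int (n choose 2) + int n"
proof -
  have "int n * (int n - 1) * (int n - 2) - 3 * int n * (int n - 1) + 6 * int n
      = 6 * (int (n choose 3) - int (n choose 2) + int n)"
    using six_mult_choose_3[of n] two_mult_choose_2[of n] by (simp add: algebra_simps)
  then show ?thesis by (simp add: three_distance_bound_def)
qed

text \<open>The first inequality ensures that a counterexample to part (1) is large enough for the
  integrality argument; the second turns the first moment bound into the required one.\<close>

lemma three_distance_bound_large:
  assumes "11 \<le> n"
  shows "int (n choose 2) \<le> three_distance_bound (int n)" "2 * d \<le> int n \<Longrightarrow> int n * d \<le> three_distance_bound (int n)"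
proof -
  have T: "6 * three_distance_bound (int n) = int n * (int n - 1) * (int n - 2) - 3 * int n * (int n - 1) + 6 * int n"
    using six_mult_choose_3[of n] two_mult_choose_2[of n] by (simp add: three_distance_bound_eq algebra_simps)
  \<comment> \<open>This product equals 6 times the difference of the two sides of the goal.\<close>
  have "0 \<le> int n * ((int n - 2) * (int n - 7))" using assms by simp
  then show "int (n choose 2) \<le> three_distance_bound (int n)"
    using T two_mult_choose_2[of n] by (simp add: algebra_simps)
  assume "2 * d \<le> int n"
  then have "int n * (2 * d) \<le> int n * int n" by (intro mult_left_mono) auto
  moreover have "0 \<le> int n * (int n * (int n - 9) + 11)" using assms by simp
  ultimately show "int n * d \<le> three_distance_bound (int n)"
    using T by (simp add: algebra_simps)
qed

text \<open>A Plotkin-type bound: linear programming with the degree 1 polynomial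
  \<open>a * b - (a + b) * d\<close>, negative at all distances from \<open>x\<close> on.\<close>

lemma first_moment_bound:
  assumes F: "uniform_family a b F" "a * b < (a + b) * x" "\<And>d. d \<in> distances F \<Longrightarrow> x \<le> d"
  shows "card F \<le> (a + b) * x"
proof -
  have val: "lp_poly (int a) (int b) c [(1, 1)] d = c + int (a * b) - int (a + b) * d" for c d
    by (simp add: lp_poly_def algebra_simps power2_eq_square)
  \<comment> \<open>This constant makes the dual polynomial vanish at \<open>x\<close> and take the
    value \<open>(a + b) * x\<close> at 0. It is a positive integer, so dividing by it can be
    omitted.\<close>
  define c where "c = int ((a + b) * x) - int (a * b)"
  have "0 < c" using F(2) unfolding c_def by linarith
  have "distance_bound a b {x..} ((a + b) * x)"
  proof (rule linear_programming_bound[of c "[(1, 1)]"])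
    show "lp_poly (int a) (int b) c [(1, 1)] (int d) \<le> 0" if "d \<in> {x..}" for d
      using that mult_left_mono[of "int x" "int d" "int (a + b)"]
      unfolding val c_def by simp
    have "int ((a + b) * x) < 1 * (int ((a + b) * x) + 1)" by simp
    also have "\<dots> \<le> c * (int ((a + b) * x) + 1)"
      using \<open>0 < c\<close> by (intro mult_right_mono) linarith+
    finally show "lp_poly (int a) (int b) c [(1, 1)] 0 < c * (int ((a + b) * x) + 1)"
      unfolding val by (simp add: c_def)
  qed (use \<open>0 < c\<close> in auto)
  then show ?thesis using F by (auto simp: distance_bound_def distances_def)
qed

text \<open>A counterexample exceeds \<open>n choose 2\<close>, so its distances form an integral
  triple, which \<open>table_1\<close> must list. The check of that entry places the weight under
  one of the three bounds, each of which contradicts the size.\<close>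

lemma three_distance_family_bound_1:
  assumes F: "uniform_family w b F" "card (distances F) = 3"
    and nw: "11 \<le> w + b" "w + b \<le> 45" "4 \<le> w" "w \<le> b"
  shows "int (card F) \<le> three_distance_bound (int (w + b))"
proof (rule ccontr)
  assume neg: "\<not> ?thesis"
  obtain x y z where xyz: "distances F = {x, y, z}" "x < y" "y < z"
    using three_element_nat_set[OF F(2)] by blast
  have pos: "0 < x" and zw: "z \<le> w" using distances_range[OF F(1)] xyz by auto
  have "(w + b) choose 2 < card F"
    using neg three_distance_bound_large(1)[OF nw(1)] by linarith
  then have "integral_triple (int x) (int y) (int z)"
    using integral_triple_distances[OF F(1) xyz] nw by simp
  then have "(int x, int y, int z) \<in> set (map key table_1)"
    unfolding table_1_complete using pos xyz zw nw by (intro in_integral_triples) auto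
  then obtain C where C: "(int x, int y, int z, C) \<in> set table_1" by fastforce
  then have check: "check_1 (int x, int y, int z, C)"
    using table_1_correct unfolding list_all_iff by blast
  then have valid: "list_all (valid_certificate (int x) (int y) (int z)) C"
    unfolding check_1.simps by blast
  let ?n = "int (w + b)"
  have nb: "?n - int w = int b" by simp
  have "?n \<in> {11..45}" using nw by simp
  then have "check_length_1 (int x) (int z) (int x + int y + int z) (map box C) ?n"
    using check unfolding check_1.simps list_all_iff set_upto by blast
  then have "scan_weights (int x) (int x + int y + int z) (map box C) ?n (three_distance_bound ?n)
      [max 4 (int z)..?n div 2]"
    by (simp add: check_length_1_def)
  then have "harmonic_case (int x + int y + int z) ?n (int w) \<or> int w * (?n - int w) < ?n * int x
      \<or> covered (map box C) (int w) (?n - int w) (three_distance_bound ?n)"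
    by (rule scan_weights) (use nw zw in auto)
  then consider "harmonic_case (int x + int y + int z) ?n (int w)"
    | "w * b < (w + b) * x" | "covered (map box C) (int w) (int b) (three_distance_bound ?n)"
    unfolding nb of_nat_mult[symmetric] of_nat_less_iff by blast
  then show False
  proof cases
    case 1
    have "card F + ((w + b) choose 2) \<le> ((w + b) choose 3) + (w + b)"
    proof (rule harmonic_bound[OF F(1), of x y z])
      show "card (S - T) \<in> {x, y, z}" if "S \<in> F" "T \<in> F" "S \<noteq> T" for S T
        using xyz(1) that by (auto simp: distances_def)
    qed (use 1 nw pos xyz in \<open>auto simp: harmonic_case_def\<close>)
    then show False using neg unfolding three_distance_bound_eq by linarith
  next
    case 2
    have "card F \<le> (w + b) * x"
      by (rule first_moment_bound[OF F(1) 2]) (use xyz in auto)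
    then have "int (card F) \<le> ?n * int x" by (metis of_nat_le_iff of_nat_mult)
    moreover have "?n * int x \<le> three_distance_bound ?n"
      using xyz zw nw by (intro three_distance_bound_large(2)) auto
    ultimately show False using neg by simp
  next
    case 3
    have nonneg: "0 \<le> three_distance_bound ?n"
      using three_distance_bound_large(1)[OF nw(1)] by linarith
    then have "distance_bound w b {x, y, z} (nat (three_distance_bound ?n))"
      using 3 by (intro covered_bound[OF valid]) simp
    then have "card F \<le> nat (three_distance_bound ?n)"
      using F(1) xyz(1) by (auto simp: distance_bound_def distances_def)
    then show False using neg nonneg by linarith
  qed
qed

text \<open>Here too a counterexample exceeds \<open>n choose 2\<close>, since the claimed bound
  does in the given range. The certificates of \<open>table_2\<close> then settle every integral
  triple without the other two bounds.\<close>

lemma three_distance_family_bound_2: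
  assumes F: "uniform_family w b F" "card (distances F) = 3"
    and nw: "11 \<le> w + b" "w + b \<le> 50" "4 \<le> w" "int w \<le> max_weight (int (w + b))"
  shows "card F \<le> (b + 3) choose 3"
proof (rule ccontr)
  assume neg: "\<not> ?thesis"
  obtain x y z where xyz: "distances F = {x, y, z}" "x < y" "y < z"
    using three_element_nat_set[OF F(2)] by blast
  have pos: "0 < x" and zw: "z \<le> w" using distances_range[OF F(1)] xyz by auto
  let ?n = "int (w + b)"
  have w: "w \<le> 8" "w + 3 \<le> b" using nw by (auto simp: max_weight_def split: if_splits)
  have "(w + b) choose 2 \<le> (b + 3) choose 3"
  proof -
    have "7 \<le> b" using w nw by simp
    \<comment> \<open>After this shift both binomials are polynomials in \<open>t\<close> with
      nonnegative coefficients and compare term by term.\<close>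
    then obtain t where t: "b = 7 + t" by (auto simp: le_iff_add)
    have "(w + b) choose 2 \<le> (b + 8) choose 2"
      using w by (intro binomial_right_mono) simp
    moreover have "6 * int ((b + 3) choose 3) = int t * (int t * int t) + 27 * (int t * int t) + 242 * int t + 720"
      using six_mult_choose_3[of "b + 3"] by (simp add: t algebra_simps)
    moreover have "2 * int ((b + 8) choose 2) = int t * int t + 29 * int t + 210"
      using two_mult_choose_2[of "b + 8"] by (simp add: t algebra_simps)
    moreover have "0 \<le> int t * int t" "0 \<le> int t * (int t * int t)" by simp_all
    ultimately show ?thesis by linarith
  qed
  then have "(w + b) choose 2 < card F" using neg by linarith
  then have "integral_triple (int x) (int y) (int z)"
    using integral_triple_distances[OF F(1) xyz] nw by simp
  then have "(int x, int y, int z) \<in> set (map key table_2)"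
    unfolding table_2_complete using pos xyz zw w by (intro in_integral_triples) auto
  then obtain C where C: "(int x, int y, int z, C) \<in> set table_2" by fastforce
  then have check: "check_2 (int x, int y, int z, C)"
    using table_2_correct unfolding list_all_iff by blast
  then have valid: "list_all (valid_certificate (int x) (int y) (int z)) C"
    unfolding check_2.simps by blast
  have "?n \<in> {11..50}" using nw by simp
  then have "check_length_2 (int z) (map box C) ?n"
    using check unfolding check_2.simps list_all_iff set_upto by blast
  then have "check_weight_2 (map box C) ?n (int w)"
    using nw zw by (auto simp: check_length_2_def list_all_iff)
  moreover have "(?n - int w + 3) * (?n - int w + 2) * (?n - int w + 1) = 6 * int ((b + 3) choose 3)"
    using six_mult_choose_3[of "b + 3"] by (simp add: algebra_simps)
  ultimately have "covered (map box C) (int w) (int b) (int ((b + 3) choose 3))"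
    unfolding check_weight_2_def by simp
  then have "distance_bound w b {x, y, z} ((b + 3) choose 3)"
    by (rule covered_bound[OF valid])
  then show False
    using F(1) xyz(1) neg by (auto simp: distance_bound_def distances_def)
qed

section \<open>Back to binary vectors\<close>

definition support :: "bit list \<Rightarrow> nat set" where
  "support x = {i. i < length x \<and> x ! i = 1}"

lemma support_johnson_space:
  assumes "x \<in> johnson_space n w"
  shows "support x \<subseteq> {..<n}" "card (support x) = w" "length x = n"
  using assms by (auto simp: johnson_space_def support_def)

lemma inj_on_support: "inj_on support (johnson_space n w)"
proof (rule inj_onI)
  fix x y assume xy: "x \<in> johnson_space n w" "y \<in> johnson_space n w" "support x = support y"
  then have len: "length x = n" "length y = n" by (auto simp: johnson_space_def)
  show "x = y"
  proof (rule nth_equalityI)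
    fix i assume "i < length x"
    then have "x ! i = 1 \<longleftrightarrow> y ! i = 1" using xy(3) len by (auto simp: support_def set_eq_iff)
    then show "x ! i = y ! i" by (metis bit_not_one_iff)
  qed (use len in simp)
qed

lemma finite_johnson_space: "finite (johnson_space n w)"
  by (rule inj_on_finite[OF inj_on_support, of _ _ "Pow {..<n}"]) (auto dest: support_johnson_space)

lemma uniform_family_support:
  assumes "X \<subseteq> johnson_space (w + b) w"
  shows "uniform_family w b (support ` X)"
  unfolding uniform_family_def using assms support_johnson_space(1,2) by blast

text \<open>Vectors of equal weight have one-sided differences of equal size, so the factor 1/2 in
  \<open>tau\<close> leaves the size of one of them.\<close>

lemma tau_eq_card_diff:
  assumes "x \<in> johnson_space n w" "y \<in> johnson_space n w"
  shows "tau x y = real (card (support x - support y))"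
proof -
  note x = support_johnson_space[OF assms(1)] and y = support_johnson_space[OF assms(2)]
  have fin: "finite (support x)" "finite (support y)" using x y by (auto intro: finite_subset)
  have "{i. i < length x \<and> x ! i \<noteq> y ! i} = (support x - support y) \<union> (support y - support x)"
    using x(3) y(3) by (auto simp: support_def)
  then have "card {i. i < length x \<and> x ! i \<noteq> y ! i} = card (support x - support y) + card (support y - support x)"
    using fin by (simp only:) (rule card_Un_disjoint; auto)
  moreover have "card (support x - support y) = card (support y - support x)"
    using fin x(2) y(2) card_Diff_subset_Int[of "support x" "support y"] card_Diff_subset_Int[of "support y" "support x"]
    by (simp add: Int_commute)
  ultimately show ?thesis by (simp add: tau_def)
qed

lemma card_distance_set:
  assumes "X \<subseteq> johnson_space n w"
  shows "card (distance_set X) = card (distances (support ` X))"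
proof -
  have "distance_set X = real ` distances (support ` X)"
  proof (intro set_eqI iffI)
    fix t assume "t \<in> distance_set X"
    then obtain x y where xy: "x \<in> X" "y \<in> X" "x \<noteq> y" "t = tau x y" by (auto simp: distance_set_def)
    then have "support x \<noteq> support y" using inj_on_support assms by (auto dest: inj_onD)
    then show "t \<in> real ` distances (support ` X)"
      using xy assms tau_eq_card_diff[of x n w y] by (fastforce simp: distances_def)
  next
    fix t assume "t \<in> real ` distances (support ` X)"
    then obtain x y where xy: "x \<in> X" "y \<in> X" "support x \<noteq> support y" "t = real (card (support x - support y))"
      by (auto simp: distances_def)
    then show "t \<in> distance_set X"
      using assms tau_eq_card_diff[of x n w y] by (fastforce simp: distance_set_def)
  qed
  then show ?thesis by (simp add: card_image)
qed

lemma card_support_image: "X \<subseteq> johnson_space n w \<Longrightarrow> card (support ` X) = card X"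
  using inj_on_support inj_on_subset by (blast intro: card_image)

lemma uniform_family_is_support_image:
  assumes F: "uniform_family w b F"
  obtains X where "X \<subseteq> johnson_space (w + b) w" "support ` X = F"
proof
  define vec :: "nat set \<Rightarrow> bit list" where "vec S = map (\<lambda>i. of_bool (i \<in> S)) [0..<w + b]" for S
  have vec: "length (vec S) = w + b" "i < w + b \<Longrightarrow> vec S ! i = of_bool (i \<in> S)" for S i
    by (simp_all add: vec_def del: upt_Suc)
  have supp: "support (vec S) = S" if "S \<in> F" for S
  proof -
    have "S \<subseteq> {..<w + b}" using F that by (auto simp: uniform_family_def)
    then show ?thesis by (auto simp: support_def vec)
  qed
  have "vec S \<in> johnson_space (w + b) w" if "S \<in> F" for S
    using F that supp[OF that] by (simp add: johnson_space_def support_def vec(1) uniform_family_def)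
  then show "vec ` F \<subseteq> johnson_space (w + b) w" by auto
  show "support ` vec ` F = F" using supp by (auto simp: image_image)
qed

text \<open>All \<open>w\<close>-sets containing \<open>w - 3\<close> fixed points: two of them
  differ only in the remaining triples, chosen among \<open>b + 3\<close> points. With
  \<open>b \<ge> 3\<close> there are disjoint triples, so distance 3 occurs.\<close>

lemma star_family:
  assumes w: "3 \<le> w" and b: "3 \<le> b"
  obtains F where "uniform_family w b F" "distances F = {1, 2, 3}" "card F = (b + 3) choose 3"
proof
  define Z where "Z = {..<w - 3}"
  define P where "P = {S. S \<subseteq> {w - 3..<w + b} \<and> card S = 3}"
  define F where "F = (\<lambda>S. Z \<union> S) ` P"
  have disj: "S \<inter> Z = {}" "finite S" if "S \<in> P" for S
    using that by (auto simp: P_def Z_def intro: finite_subset)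
  have inj: "inj_on (\<lambda>S. Z \<union> S) P"
    by (rule inj_onI) (use disj in blast)
  have diff: "(Z \<union> S) - (Z \<union> T) = S - T" if "S \<in> P" "T \<in> P" for S T
    using disj that by auto
  show F: "uniform_family w b F"
    unfolding uniform_family_def F_def
  proof (intro ballI conjI; elim imageE)
    fix R S assume R: "R = Z \<union> S" and S: "S \<in> P"
    show "R \<subseteq> {..<w + b}" using R S w by (auto simp: P_def Z_def)
    show "card R = w"
      using R S disj[OF S] w by (subst R, subst card_Un_disjoint) (auto simp: P_def Z_def)
  qed
  have "card F = card P" unfolding F_def by (rule card_image[OF inj])
  also have "\<dots> = (b + 3) choose 3" unfolding P_def using w by (subst n_subsets) auto
  finally show "card F = (b + 3) choose 3" .
  show "distances F = {1, 2, 3}"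
  proof
    show "distances F \<subseteq> {1, 2, 3}"
    proof
      fix d assume d: "d \<in> distances F"
      then obtain S T where ST: "S \<in> P" "T \<in> P" "d = card ((Z \<union> S) - (Z \<union> T))"
        unfolding distances_def F_def by blast
      then have "d = card (S - T)" using diff by simp
      with ST(1,2) have ST: "S \<in> P" "T \<in> P" "d = card (S - T)" by auto
      have "d \<le> 3" using ST disj(2)[OF ST(1)] card_mono[of S "S - T"] by (auto simp: P_def)
      moreover have "0 < d" using distances_range[OF F d] by simp
      ultimately show "d \<in> {1, 2, 3}" by auto
    qed
    define p where "p = w - 3"
    have mem: "{i, j, k} \<in> P" if "distinct [i, j, k]" "{i, j, k} \<subseteq> {p..p + 5}" for i j k
      using that w b by (auto simp: P_def p_def)
    have dist: "card (S - T) \<in> distances F" if "S \<in> P" "T \<in> P" "S - T \<noteq> {}" for S T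
    proof -
      have "Z \<union> S \<in> F" "Z \<union> T \<in> F" "Z \<union> S \<noteq> Z \<union> T"
        using that diff[OF that(1,2)] by (auto simp: F_def)
      then show ?thesis unfolding distances_def diff[OF that(1,2), symmetric] by blast
    qed
    \<comment> \<open>The first triple is at distances 1, 2 and 3 from the other three.\<close>
    have P: "{p, p + 1, p + 2} \<in> P" "{p, p + 1, p + 3} \<in> P" "{p, p + 3, p + 4} \<in> P" "{p + 3, p + 4, p + 5} \<in> P"
      by (rule mem; simp)+
    have "{p, p + 1, p + 2} - {p, p + 1, p + 3} = {p + 2}"
      "{p, p + 1, p + 2} - {p, p + 3, p + 4} = {p + 1, p + 2}"
      "{p, p + 1, p + 2} - {p + 3, p + 4, p + 5} = {p, p + 1, p + 2}" by auto
    then have "card {p + 2} \<in> distances F" "card {p + 1, p + 2} \<in> distances F"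
      "card {p, p + 1, p + 2} \<in> distances F"
      using dist[OF P(1,2)] dist[OF P(1,3)] dist[OF P(1,4)] by (metis insert_not_empty)+
    then show "{1, 2, 3} \<subseteq> distances F" by (simp add: numeral_2_eq_2 numeral_3_eq_3)
  qed
qed

theorem theorem3p5:
  fixes n w :: nat
  assumes "2 * w \<le> n"
  shows "(11 \<le> n \<and> n \<le> 45 \<and> 4 \<le> w \<and> real w \<le> real n / 2 \<longrightarrow>
           int (max_s_distance n w 3) \<le> int (n choose 3) - int (n choose 2) + int n)
       \<and> ((11 \<le> n \<and> n \<le> 12 \<and> w = 4) \<or>
          (13 \<le> n \<and> n \<le> 15 \<and> 4 \<le> w \<and> w \<le> 5) \<or>
          (16 \<le> n \<and> n \<le> 19 \<and> 4 \<le> w \<and> w \<le> 6) \<or>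
          (20 \<le> n \<and> n \<le> 24 \<and> 4 \<le> w \<and> w \<le> 7) \<or>
          (25 \<le> n \<and> n \<le> 50 \<and> 4 \<le> w \<and> w \<le> 8) \<longrightarrow>
           max_s_distance n w 3 = (n - w + 3) choose 3)"
proof -
  define b where "b = n - w"
  have n: "n = w + b" and wb: "w \<le> b" using assms by (auto simp: b_def)
  define \<X> where "\<X> = {X. X \<subseteq> johnson_space n w \<and> card (distance_set X) = 3}"
  have max: "max_s_distance n w 3 = Max (card ` \<X>)" by (simp add: max_s_distance_def \<X>_def)
  have fin: "finite (card ` \<X>)"
    by (rule finite_imageI, rule finite_subset[of _ "Pow (johnson_space n w)"])
      (auto simp: \<X>_def finite_johnson_space)
  have family: "uniform_family w b (support ` X)" "card (distances (support ` X)) = 3"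
    "card (support ` X) = card X" if "X \<in> \<X>" for X
    using that uniform_family_support[of X w b] card_distance_set[of X n w] card_support_image[of X n w]
    by (auto simp: \<X>_def n)
  \<comment> \<open>This family attains the value in part (2); in part (1) it ensures that the
    maximum is taken over a nonempty set.\<close>
  have star: "\<exists>X\<in>\<X>. card X = (b + 3) choose 3" if h: "4 \<le> w"
  proof -
    obtain F where F: "uniform_family w b F" "distances F = {1, 2, 3}" "card F = (b + 3) choose 3"
      by (rule star_family[of w b]) (use h wb in simp_all)
    obtain X where X: "X \<subseteq> johnson_space n w" "support ` X = F"
      using uniform_family_is_support_image[OF F(1)] n by auto
    have "X \<in> \<X>" using X F card_distance_set[OF X(1)] by (simp add: \<X>_def)
    moreover have "card X = (b + 3) choose 3" using X F card_support_image[OF X(1)] by simp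
    ultimately show ?thesis by blast
  qed
  have part1: "int (max_s_distance n w 3) \<le> int (n choose 3) - int (n choose 2) + int n"
    if h: "11 \<le> n" "n \<le> 45" "4 \<le> w"
  proof -
    have "Max (card ` \<X>) \<in> card ` \<X>" using star[OF h(3)] fin by (intro Max_in) auto
    then obtain X where X: "X \<in> \<X>" "Max (card ` \<X>) = card X" by auto
    have "int (card X) \<le> three_distance_bound (int (w + b))"
      using three_distance_family_bound_1[OF family(1,2)[OF X(1)]] family(3)[OF X(1)] h wb by (simp add: n)
    then show ?thesis by (simp add: max X three_distance_bound_eq flip: n)
  qed
  have part2: "max_s_distance n w 3 = (n - w + 3) choose 3"
    if h: "11 \<le> n" "n \<le> 50" "4 \<le> w" "int w \<le> max_weight (int n)"
  proof -
    have "Max (card ` \<X>) = (b + 3) choose 3"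
    proof (rule Max_eqI[OF fin])
      show "c \<le> (b + 3) choose 3" if "c \<in> card ` \<X>" for c
      proof -
        obtain X where X: "X \<in> \<X>" "c = card X" using \<open>c \<in> card ` \<X>\<close> by auto
        then show ?thesis
          using three_distance_family_bound_2[OF family(1,2)[OF X(1)]] family(3)[OF X(1)] h by (simp add: n)
      qed
      show "(b + 3) choose 3 \<in> card ` \<X>" using star[OF h(3)] by force
    qed
    then show ?thesis by (simp add: max b_def)
  qed
  show ?thesis
    using part1 part2 by (auto simp: max_weight_def)
qed

end
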